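(* Grant (Lip-Conv), (Conv), (Inl) and (Bern-MOM) from the context, and assume $|\mathcal O|\le 3N/7$. Let $\gamma=1/(575AL)$ and let $K\in[7|\mathcal O|/3,N]$ (with $K$ dividing $N$). Then the minmax MOM estimator $\hat f$ satisfies, with probability at least $1-\exp(-K/2016)$, $$\|\hat f-f^*\|_{L_2}^2\le C_{K,r}\qquad\text{and}\qquad P\mathcal L_{\hat f}\le\frac{2}{3A}C_{K,r},$$ where $C_{K,r}=\max\big(\tilde r_2^2(1/(575AL)),\,864A^2L^2K/N\big)$.
   Context: Setting: $\mathcal X,\mathcal Y$ measurable spaces, $\bar{\mathcal Y}\subset\mathbb R$ convex containing all values $f(x)$, $F\subset L_2(\mu)$ a class of measurable functions $\mathcal X\to\bar{\mathcal Y}$, $\bar\ell:\bar{\mathcal Y}\times\mathcal Y\to\mathbb R$, $\ell_f(x,y)=\bar\ell(f(x),y)$. $(X,Y)$ has distribution $P$, $X$ has distribution $\mu$, $Pg=\mathbb Eg(X,Y)$. The risk $R(f)=P\ell_f$ has unique minimizer $f^*$ over $F$; $\mathcal L_f=\ell_f-\ell_{f^*}$. $\|g\|_{L_p}=(\mathbb E|g(X)|^p)^{1/p}$. (Lip-Conv): there is $L>0$ such that for all $y\in\mathcal Y$, $u\mapsto\bar\ell(u,y)$ is convex and $L$-Lipschitz. (Conv): $F$ is convex. Data: $(X_i,Y_i)_{i=1}^N$, where $\{1,\dots,N\}=\mathcal O\cup\mathcal I$ is a partition unknown to the statistician; nothing is assumed on $(X_i,Y_i)_{i\in\mathcal O}$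 (outliers). (Inl): $(X_i,Y_i)_{i\in\mathcal I}$ are independent, $(X_i,Y_i)\sim P_i$, $X_i\sim\mu_i$, and for all $i\in\mathcal I$ and $f\in F$: $\|f-f^*\|_{L_2(\mu_i)}=\|f-f^*\|_{L_2}$ and $P_i\mathcal L_f=P\mathcal L_f$. MOM: for $K$ dividing $N$, let $B_1,\dots,B_K$ be a partition of $\{1,\dots,N\}$ into blocks of size $N/K$, $P_{B_k}g=\frac KN\sum_{i\in B_k}g(X_i,Y_i)$, and $\mathrm{MOM}_K(g)$ the median of $P_{B_1}g,\dots,P_{B_K}g$. The minmax MOM estimator is any $\hat f\in\operatorname{argmin}_{f\in F}\sup_{g\in F}\mathrm{MOM}_K(\ell_f-\ell_g)$. Complexity: $(\sigma_i)$ are i.i.d. Rademacher variables independent of the data; for $\gamma>0$, $\tilde r_2(\gamma)$ is a positive number with $\tilde r_2(\gamma)\ge\inf\{r>0:\forall J\subset\mathcal I\text{ with }|J|\ge N/2,\ \mathbb E\sup_{f\in F:\|f-f^*\|_{L_2}\le r}|\sum_{i\in J}\sigma_i(f-f^* )(X_i)|\le r^2|J|\gamma\}$. (Bern-MOM): there is $A>0$ such that every $f\in F$ with $\|f-f^*\|_{L_2}^2=C_{K,r}$ satisfies $\|f-f^*\|_{L_2}^2\le A\,P\mathcal L_f$, where $C_{K,r}=\max(\tilde r_2^2(1/(575AL)),864A^2L^2K/N)$. *)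

theory Defs
  imports "HOL-Probability.Probability"
begin

definition L2norm :: "'x measure \<Rightarrow> ('x \<Rightarrow> real) \<Rightarrow> real" where
  "L2norm \<mu> g = sqrt (\<integral>x. (g x)\<^sup>2 \<partial>\<mu>)"

definition excess_risk ::
  "('x \<times> 'y) measure \<Rightarrow> (real \<Rightarrow> 'y \<Rightarrow> real) \<Rightarrow> ('x \<Rightarrow> real) \<Rightarrow> ('x \<Rightarrow> real) \<Rightarrow> real" where
  "excess_risk Q lbar f fs = (\<integral>z. lbar (f (fst z)) (snd z) - lbar (fs (fst z)) (snd z) \<partial>Q)"

text \<open>Outer (upper) nonnegative expectation, used for possibly non-measurable suprema.\<close>
definition outer_nn_integral :: "'a measure \<Rightarrow> ('a \<Rightarrow> ennreal) \<Rightarrow> ennreal" where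
  "outer_nn_integral M g =
     (INF h \<in> {h \<in> borel_measurable M. \<forall>x\<in>space M. g x \<le> h x}. nn_integral M h)"

definition rademacher :: "real measure" where
  "rademacher = measure_pmf (pmf_of_set {-1, 1})"

definition is_median :: "nat \<Rightarrow> (nat \<Rightarrow> real) \<Rightarrow> real \<Rightarrow> bool" where
  "is_median K v m \<longleftrightarrow>
     2 * card {k \<in> {1..K}. v k \<le> m} \<ge> K \<and> 2 * card {k \<in> {1..K}. v k \<ge> m} \<ge> K"

text \<open>Block empirical mean  P_{B} g = (K/N) sum_{i in B} g(X_i,Y_i), with h i = g(X_i,Y_i).\<close>
definition block_mean :: "nat \<Rightarrow> nat \<Rightarrow> nat set \<Rightarrow> (nat \<Rightarrow> real) \<Rightarrow> real" where
  "block_mean N K Bk h = (real K / real N) * (\<Sum>i\<in>Bk. h i)"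

definition MOM :: "((nat \<Rightarrow> real) \<Rightarrow> real) \<Rightarrow> nat \<Rightarrow> nat \<Rightarrow> (nat \<Rightarrow> nat set) \<Rightarrow> (nat \<Rightarrow> real) \<Rightarrow> real" where
  "MOM med N K B h = med (\<lambda>k. block_mean N K (B k) h)"

definition minmax_MOM_crit ::
  "((nat \<Rightarrow> real) \<Rightarrow> real) \<Rightarrow> nat \<Rightarrow> nat \<Rightarrow> (nat \<Rightarrow> nat set) \<Rightarrow> (real \<Rightarrow> 'y \<Rightarrow> real)
    \<Rightarrow> ('x \<Rightarrow> real) set \<Rightarrow> (nat \<Rightarrow> 'x \<times> 'y) \<Rightarrow> ('x \<Rightarrow> real) \<Rightarrow> ereal" where
  "minmax_MOM_crit med N K B lbar F z f =
     (SUP g\<in>F. ereal (MOM med N K B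
        (\<lambda>i. lbar (f (fst (z i))) (snd (z i)) - lbar (g (fst (z i))) (snd (z i)))))"

definition is_minmax_MOM ::
  "((nat \<Rightarrow> real) \<Rightarrow> real) \<Rightarrow> nat \<Rightarrow> nat \<Rightarrow> (nat \<Rightarrow> nat set) \<Rightarrow> (real \<Rightarrow> 'y \<Rightarrow> real)
    \<Rightarrow> ('x \<Rightarrow> real) set \<Rightarrow> (nat \<Rightarrow> 'x \<times> 'y) \<Rightarrow> ('x \<Rightarrow> real) \<Rightarrow> bool" where
  "is_minmax_MOM med N K B lbar F z fh \<longleftrightarrow>
     fh \<in> F \<and> (\<forall>f\<in>F. minmax_MOM_crit med N K B lbar F z fh \<le> minmax_MOM_crit med N K B lbar F z f)"

text \<open>Localized Rademacher complexity condition defining r2~(gamma):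
  for all J \<subseteq> I with |J| \<ge> N/2,
  E sup_{f\<in>F, ||f - fs|| \<le> r} |sum_{i\<in>J} sigma_i (f - fs)(X_i)| \<le> r^2 |J| gamma,
  where X_i ~ mu_i independent (i \<in> J) and sigma_i iid Rademacher independent of them.\<close>
definition rad_condition ::
  "('x measure) \<Rightarrow> (nat \<Rightarrow> 'x measure) \<Rightarrow> ('x \<Rightarrow> real) set \<Rightarrow> ('x \<Rightarrow> real)
     \<Rightarrow> nat set \<Rightarrow> nat \<Rightarrow> real \<Rightarrow> real \<Rightarrow> bool" where
  "rad_condition \<mu> \<mu>i F fs I N \<gamma> r \<longleftrightarrow>
     (\<forall>J. J \<subseteq> I \<and> 2 * card J \<ge> N \<longrightarrow>
        outer_nn_integral (PiM J (\<lambda>i. \<mu>i i \<Otimes>\<^sub>M rademacher))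
          (\<lambda>w. SUP f\<in>{f \<in> F. L2norm \<mu> (\<lambda>x. f x - fs x) \<le> r}.
                 ennreal \<bar>\<Sum>i\<in>J. snd (w i) * (f (fst (w i)) - fs (fst (w i)))\<bar>)
        \<le> ennreal (r\<^sup>2 * real (card J) * \<gamma>))"

end

theory Submission
  imports Defs
begin

text \<open>
  Count the bad blocks of a function \<open>f\<close> in the \<open>L\<^sub>2\<close>-ball through \<open>min 1 (t\<^sup>2)\<close>, where \<open>t\<close> is the
  normalised deviation of the block mean. This function of \<open>t\<close> is 2-Lipschitz and its expectation is at most
  the variance of \<open>t\<close>, which is at most \<open>1 / 96\<close>. McDiarmid's inequality over the \<open>n\<close> outlier-free blocks costs
  \<open>n / 48\<close>. Symmetrization and contraction, once over blocks and once over observations, bound the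
  expected supremum by twice \<open>24 n / 575\<close>. The total is less than \<open>n / 8\<close>, and \<open>n \<ge> 4 K / 7\<close>, so more than
  \<open>K / 2\<close> blocks are good for all \<open>f\<close> in the ball simultaneously; the rest is deterministic.

  Suprema over \<open>F\<close> need not be measurable, and an outer expectation does not commute with the average over
  signs that the usual contraction argument takes pointwise. Instead of suprema we therefore transform
  families of measurable majorants, one for every sign pattern. Contraction acts on such families
  explicitly: majorants \<open>U\<^sub>+\<close> and \<open>U\<^sub>-\<close> that differ in one sign are replaced by
  \<open>(U\<^sub>+ + U\<^sub>-) / 2 \<plusminus> \<psi> ((U\<^sub>+ - U\<^sub>-) / 2)\<close>.
\<close>

subsection \<open>Bounded differences without measurability\<close>

text \<open>Origin of the constants. A block is bad when its mean misses the excess risk by more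
  than \<open>C / (3 * A)\<close>, a third of what the Bernstein condition guarantees on the sphere.
  Since \<open>C\<close> is at least \<open>864 * A^2 * L^2 * K / N\<close>, the normalised variance
  is at most 9/864 = 1/96. The factor 8 in the block bound is 2 * 2 * 2: two symmetrizations and the
  Lipschitz constant of the truncated square. With \<open>\<gamma> = 1 / (575 * A * L)\<close> it
  yields 48/575, even though the complexity bound is first enlarged by a factor 2 to pay for infima
  that need not be attained. The sum 1/96 + 48/575 + 1/48 stays below 1/8, and 1/8 is the right
  target because (7/8) * (4/7) = 1/2. The exponent is 2 * (n/48)^2 / n = n/1152, and n >= 4K/7 turns
  it into K/2016. Signs appear on two levels because the complexity speaks of single observations
  while bounded differences are used per block. The bridge is that a sign pattern on blocks is a
  pattern on observations that is constant on each block.\<close>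

lemma AE_mp_space:
  assumes "AE x in M. P x" and "\<And>x. x \<in> space M \<Longrightarrow> P x \<Longrightarrow> Q x"
  shows "AE x in M. Q x"
  using assms(1) by (rule AE_mp) (simp add: assms(2) AE_I2)

text \<open>A pairwise oscillation bound forces the essential supremum and infimum to differ by at
  most \<open>c\<close>, so \<open>X\<close> lies almost surely in an interval of that length and
  Hoeffding's lemma applies.\<close>

lemma (in prob_space) mgf_bound_pairwise_range:
  fixes X :: "'a \<Rightarrow> real"
  assumes [measurable]: "X \<in> borel_measurable M" and bd: "\<And>y. y \<in> space M \<Longrightarrow> \<bar>X y\<bar> \<le> C"
    and osc: "AE y in M. AE w in M. X y \<le> X w + c" and l: "l > 0" and c: "c \<ge> 0"
  shows "expectation (\<lambda>y. exp (l * X y)) \<le> exp (l * expectation X + l\<^sup>2 * c\<^sup>2 / 8)"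
proof -
  define s where "s = esssup M X"
  have X_le_s: "AE y in M. ereal (X y) \<le> s"
    unfolding s_def by (rule esssup_AE)
  have "s \<le> ereal C"
    unfolding s_def using bd by (intro esssup_I) (auto simp: abs_le_iff)
  moreover have "s \<noteq> -\<infinity>"
  proof
    assume "s = -\<infinity>"
    with X_le_s have "AE y in M. False" by simp
    then show False by simp
  qed
  ultimately obtain b where b: "s = ereal b" by (cases s) auto
  have "AE y in M. X y \<le> b" using X_le_s b by simp
  moreover have "AE w in M. b - c \<le> X w"
  proof -
    \<comment> \<open>\<open>t\<close> is minus the essential infimum of \<open>X\<close>. Almost
      every \<open>y\<close> bounds it by \<open>c - X y\<close>; read the other way, this bounds
      the essential supremum of \<open>X\<close> by \<open>c - t\<close>.\<close>
    define t where "t = esssup M (\<lambda>w. - X w)"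
    have t: "AE w in M. ereal (- X w) \<le> t" unfolding t_def by (rule esssup_AE)
    have "AE y in M. t \<le> ereal (c - X y)"
      using osc
    proof eventually_elim
      case (elim y)
      then show ?case unfolding t_def
        by (intro esssup_I) (auto elim!: eventually_mono)
    qed
    moreover have "t \<noteq> -\<infinity>"
    proof
      assume "t = -\<infinity>"
      with t have "AE y in M. False" by simp
      then show False by simp
    qed
    moreover have "\<exists>y. t \<le> ereal (c - X y)"
    proof (rule ccontr)
      assume "\<not> ?thesis"
      with calculation(1) have "AE y in M. False" by simp
      then show False by simp
    qed
    ultimately obtain t' where t': "t = ereal t'" by (cases t) auto
    have "AE y in M. X y \<le> c - t'" using \<open>AE y in M. t \<le> ereal (c - X y)\<close> t' by (auto elim!: eventually_mono)
    then have "s \<le> ereal (c - t')" unfolding s_def by (intro esssup_I) auto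
    with b have "b - c \<le> - t'" by simp
    then show ?thesis using t t' by (auto elim!: eventually_mono)
  qed
  ultimately have "AE y in M. X y \<in> {b - c..b}" by eventually_elim auto
  then interpret X: interval_bounded_random_variable M X "b - c" b
    by unfold_locales auto
  have int: "integrable M (\<lambda>y. exp (l * (X y - expectation X)))"
  proof (rule integrable_const_bound[where B="exp (l * (C + \<bar>expectation X\<bar>))"])
    show "AE y in M. norm (exp (l * (X y - expectation X))) \<le> exp (l * (C + \<bar>expectation X\<bar>))"
      using bd l by (auto simp: abs_le_iff intro!: AE_I2) fastforce
  qed simp
  have "ennreal (expectation (\<lambda>y. exp (l * (X y - expectation X)))) =
      (\<integral>\<^sup>+y. exp (l * (X y - expectation X)) \<partial>M)"
    by (rule nn_integral_eq_integral[symmetric]) (use int in auto)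
  also have "\<dots> \<le> ennreal (exp (l\<^sup>2 * c\<^sup>2 / 8))"
    using X.Hoeffdings_lemma_nn_integral[OF l] by simp
  finally have "expectation (\<lambda>y. exp (l * (X y - expectation X))) \<le> exp (l\<^sup>2 * c\<^sup>2 / 8)"
    by simp
  then have "exp (l * expectation X) * expectation (\<lambda>y. exp (l * (X y - expectation X)))
      \<le> exp (l * expectation X) * exp (l\<^sup>2 * c\<^sup>2 / 8)"
    by (intro mult_left_mono) auto
  also have "exp (l * expectation X) * expectation (\<lambda>y. exp (l * (X y - expectation X)))
      = expectation (\<lambda>y. exp (l * X y))"
    by (subst integral_mult_right_zero[symmetric]) (simp add: exp_add[symmetric] algebra_simps add_divide_distrib)
  finally show ?thesis by (simp add: exp_add)
qed

lemma (in product_prob_space) AE_PiM_insert: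
  assumes "finite J" "i \<notin> J" and AE: "AE z in PiM (insert i J) M. Q z"
  shows "AE x in PiM J M. AE y in M i. Q (x(i := y))"
proof -
  interpret J: prob_space "PiM J M" by (rule prob_space_PiM) (rule prob_space)
  interpret P: pair_sigma_finite "M i" "PiM J M" ..
  interpret P': pair_sigma_finite "PiM J M" "M i" ..
  have [measurable]: "(\<lambda>(x, X). X(i := x)) \<in> M i \<Otimes>\<^sub>M PiM J M \<rightarrow>\<^sub>M PiM (insert i J) M"
    unfolding split_beta' by (rule measurable_fun_upd[where J=J]) auto
  have "AE z in distr (M i \<Otimes>\<^sub>M PiM J M) (PiM (insert i J) M) (\<lambda>(x, X). X(i := x)). Q z"
    using AE by (subst distr_pair_PiM_eq_PiM) (auto intro: prob_space)
  from AE_distrD[OF _ this] have "AE p in M i \<Otimes>\<^sub>M PiM J M. Q ((snd p)(i := fst p))"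
    by (simp add: split_beta')
  then have "AE p in distr (PiM J M \<Otimes>\<^sub>M M i) (M i \<Otimes>\<^sub>M PiM J M) (\<lambda>(x, y). (y, x)). Q ((snd p)(i := fst p))"
    by (simp only: P.distr_pair_swap[symmetric])
  from AE_distrD[OF _ this] have "AE p in PiM J M \<Otimes>\<^sub>M M i. Q ((fst p)(i := snd p))"
    by (simp add: split_beta')
  from P'.AE_pair[OF this] show ?thesis by simp
qed

text \<open>The coordinates are integrated out one at a time: the section integral \<open>h1\<close>
  keeps bounded differences in the remaining coordinates, and Hoeffding's lemma in coordinate
  \<open>i\<close> contributes the factor \<open>exp (l^2 * c^2 / 8)\<close>. Differences are
  assumed only almost everywhere, which is all that a minimal majorant provides.\<close>

lemma (in product_prob_space) mgf_bounded_differences: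
  fixes h :: "('i \<Rightarrow> 'a) \<Rightarrow> real"
  assumes "finite J" and "h \<in> borel_measurable (PiM J M)"
    and "\<And>z. z \<in> space (PiM J M) \<Longrightarrow> \<bar>h z\<bar> \<le> C"
    and "\<And>i. i \<in> J \<Longrightarrow> AE z in PiM J M. AE w in M i. h z \<le> h (z(i := w)) + c"
    and l: "l > 0" and c: "c \<ge> 0"
  shows "(\<integral>z. exp (l * h z) \<partial>PiM J M) \<le> exp (l * (\<integral>z. h z \<partial>PiM J M) + real (card J) * (l\<^sup>2 * c\<^sup>2 / 8))"
  using assms(1-4)
proof (induction J arbitrary: h)
  case empty
  then show ?case by (simp add: PiM_empty lebesgue_integral_count_space_finite)
next
  case (insert i J)
  note [measurable] = insert.prems(1)
  interpret PI: prob_space "PiM J M" by (rule prob_space_PiM) (rule prob_space)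
  interpret PII: prob_space "PiM (insert i J) M" by (rule prob_space_PiM) (rule prob_space)
  have meas_upd [measurable]: "(\<lambda>p. (fst p)(i := snd p)) \<in> PiM J M \<Otimes>\<^sub>M M i \<rightarrow>\<^sub>M PiM (insert i J) M"
    by (rule measurable_fun_upd[where J=J]) auto
  have upd_space: "x(i := y) \<in> space (PiM (insert i J) M)" if "x \<in> space (PiM J M)" "y \<in> space (M i)" for x y
    using measurable_space[OF meas_upd, of "(x, y)"] that by (simp add: space_pair_measure)
  define h1 where "h1 x = (\<integral>y. h (x(i := y)) \<partial>M i)" for x
  have h1_meas [measurable]: "h1 \<in> borel_measurable (PiM J M)"
    unfolding h1_def by measurable
  have sec_meas: "(\<lambda>y. h (x(i := y))) \<in> borel_measurable (M i)" if "x \<in> space (PiM J M)" for x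
    using that by measurable
  have bd: "\<bar>h (x(i := y))\<bar> \<le> C" if "x \<in> space (PiM J M)" "y \<in> space (M i)" for x y
    using upd_space[OF that] insert.prems(2) by blast
  have sec_int: "integrable (M i) (\<lambda>y. h (x(i := y)))" if "x \<in> space (PiM J M)" for x
    using that bd sec_meas by (intro M.integrable_const_bound[where B=C]) auto
  have int_h: "integrable (PiM (insert i J) M) h"
    using insert.prems(2) by (intro PII.integrable_const_bound[where B=C]) auto
  have exp_bd: "exp (l * h z) \<le> exp (l * C)" if "z \<in> space (PiM (insert i J) M)" for z
    using insert.prems(2)[OF that] l by auto
  have int_exp: "integrable (PiM (insert i J) M) (\<lambda>z. exp (l * h z))"
    using exp_bd by (intro PII.integrable_const_bound[where B="exp (l * C)"]) auto
  have h1_bd: "\<bar>h1 x\<bar> \<le> C" if x: "x \<in> space (PiM J M)" for x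
  proof -
    have "\<bar>h1 x\<bar> \<le> (\<integral>y. \<bar>h (x(i := y))\<bar> \<partial>M i)"
      unfolding h1_def using integral_abs_bound by blast
    also have "\<dots> \<le> (\<integral>y. C \<partial>M i)"
      using bd x sec_int by (intro integral_mono) auto
    finally show ?thesis by (simp add: M.prob_space)
  qed
  \<comment> \<open>Integrating over \<open>y\<close> requires the inequality for almost every
    \<open>y\<close> at a fixed \<open>w\<close>, so the two almost-everywhere quantifiers must be
    exchanged.\<close>
  have h1_osc: "AE x in PiM J M. AE w in M j. h1 x \<le> h1 (x(j := w)) + c" if j: "j \<in> J" for j
  proof -
    have "i \<noteq> j" using j insert.hyps by auto
    have xj: "x(j := w) \<in> space (PiM J M)" if "x \<in> space (PiM J M)" "w \<in> space (M j)" for x w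
      using that j by (auto simp: space_PiM PiE_iff extensional_def)
    have "AE z in PiM (insert i J) M. AE w in M j. h z \<le> h (z(j := w)) + c"
      using j insert.prems(3) by blast
    from AE_PiM_insert[OF insert.hyps this]
    have "AE x in PiM J M. AE y in M i. AE w in M j. h (x(i := y)) \<le> h (x(j := w, i := y)) + c"
      using \<open>i \<noteq> j\<close> by (simp add: fun_upd_twist)
    then show ?thesis
    proof (rule AE_mp_space)
      fix x assume x: "x \<in> space (PiM J M)"
        and *: "AE y in M i. AE w in M j. h (x(i := y)) \<le> h (x(j := w, i := y)) + c"
      interpret P: pair_sigma_finite "M i" "M j" ..
      have [measurable]: "(\<lambda>p. x(j := snd p)) \<in> M i \<Otimes>\<^sub>M M j \<rightarrow>\<^sub>M PiM J M"
        using j x by (intro measurable_fun_upd[where J=J]) auto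
      have [measurable]: "(\<lambda>p. x(j := snd p, i := fst p)) \<in> M i \<Otimes>\<^sub>M M j \<rightarrow>\<^sub>M PiM (insert i J) M"
        by (rule measurable_fun_upd[where J=J]) auto
      have [measurable]: "(\<lambda>p. x(i := fst p)) \<in> M i \<Otimes>\<^sub>M M j \<rightarrow>\<^sub>M PiM (insert i J) M"
        using x by (intro measurable_fun_upd[where J=J]) auto
      from * have "AE w in M j. AE y in M i. h (x(i := y)) \<le> h (x(j := w, i := y)) + c"
        by (subst (asm) P.AE_commute) auto
      then show "AE w in M j. h1 x \<le> h1 (x(j := w)) + c"
      proof (rule AE_mp_space)
        fix w assume w: "w \<in> space (M j)" and "AE y in M i. h (x(i := y)) \<le> h (x(j := w, i := y)) + c"
        then have "h1 x \<le> (\<integral>y. h (x(j := w, i := y)) + c \<partial>M i)"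
          unfolding h1_def using sec_int x xj[OF x w]
          by (intro integral_mono_AE) (auto intro!: Bochner_Integration.integrable_add)
        also have "\<dots> = h1 (x(j := w)) + c"
          unfolding h1_def using sec_int[OF xj[OF x w]]
          by (subst Bochner_Integration.integral_add) (auto simp: M.prob_space)
        finally show "h1 x \<le> h1 (x(j := w)) + c" .
      qed
    qed
  qed
  have IH: "(\<integral>x. exp (l * h1 x) \<partial>PiM J M) \<le> exp (l * (\<integral>x. h1 x \<partial>PiM J M) + real (card J) * (l\<^sup>2 * c\<^sup>2 / 8))"
    by (rule insert.IH[OF h1_meas h1_bd h1_osc])
  have "AE z in PiM (insert i J) M. AE w in M i. h z \<le> h (z(i := w)) + c"
    using insert.prems(3) by blast
  from AE_PiM_insert[OF insert.hyps this]
  have inner: "AE x in PiM J M. (\<integral>y. exp (l * h (x(i := y))) \<partial>M i) \<le> exp (l * h1 x + l\<^sup>2 * c\<^sup>2 / 8)"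
  proof (rule AE_mp_space)
    fix x assume x: "x \<in> space (PiM J M)" and *: "AE y in M i. AE w in M i. h (x(i := y)) \<le> h (x(i := y, i := w)) + c"
    show "(\<integral>y. exp (l * h (x(i := y))) \<partial>M i) \<le> exp (l * h1 x + l\<^sup>2 * c\<^sup>2 / 8)"
      unfolding h1_def
      by (rule M.mgf_bound_pairwise_range[where C=C]) (use sec_meas[OF x] bd x * l c in auto)
  qed
  have "(\<integral>z. exp (l * h z) \<partial>PiM (insert i J) M) = (\<integral>x. (\<integral>y. exp (l * h (x(i := y))) \<partial>M i) \<partial>PiM J M)"
    by (rule product_integral_insert[OF insert.hyps int_exp])
  also have "\<dots> \<le> (\<integral>x. exp (l\<^sup>2 * c\<^sup>2 / 8) * exp (l * h1 x) \<partial>PiM J M)"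
  proof (rule integral_mono_AE)
    show "integrable (PiM J M) (\<lambda>x. \<integral>y. exp (l * h (x(i := y))) \<partial>M i)"
    proof (rule PI.integrable_const_bound[where B="exp (l * C)"])
      show "AE x in PiM J M. norm (\<integral>y. exp (l * h (x(i := y))) \<partial>M i) \<le> exp (l * C)"
      proof (rule AE_I2)
        fix x assume x: "x \<in> space (PiM J M)"
        have "(\<integral>y. exp (l * h (x(i := y))) \<partial>M i) \<le> (\<integral>y. exp (l * C) \<partial>M i)"
          using exp_bd[OF upd_space[OF x]] sec_meas[OF x]
          by (intro integral_mono M.integrable_const_bound[where B="exp (l * C)"]) auto
        then show "norm (\<integral>y. exp (l * h (x(i := y))) \<partial>M i) \<le> exp (l * C)"
          by (simp add: M.prob_space)
      qed
    qed measurable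
    show "integrable (PiM J M) (\<lambda>x. exp (l\<^sup>2 * c\<^sup>2 / 8) * exp (l * h1 x))"
    proof (intro integrable_mult_right PI.integrable_const_bound[where B="exp (l * C)"])
      show "AE x in PiM J M. norm (exp (l * h1 x)) \<le> exp (l * C)"
        using h1_bd l by (auto simp: abs_le_iff)
    qed measurable
    show "AE x in PiM J M. (\<integral>y. exp (l * h (x(i := y))) \<partial>M i) \<le> exp (l\<^sup>2 * c\<^sup>2 / 8) * exp (l * h1 x)"
      using inner by (simp add: exp_add mult.commute)
  qed
  also have "\<dots> = exp (l\<^sup>2 * c\<^sup>2 / 8) * (\<integral>x. exp (l * h1 x) \<partial>PiM J M)" by simp
  also have "\<dots> \<le> exp (l\<^sup>2 * c\<^sup>2 / 8) * exp (l * (\<integral>x. h1 x \<partial>PiM J M) + real (card J) * (l\<^sup>2 * c\<^sup>2 / 8))"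
    using IH by (intro mult_left_mono) auto
  also have "(\<integral>x. h1 x \<partial>PiM J M) = (\<integral>z. h z \<partial>PiM (insert i J) M)"
    unfolding h1_def by (rule product_integral_insert[OF insert.hyps int_h, symmetric])
  finally show ?case
    using insert.hyps by (simp add: exp_add[symmetric] algebra_simps add_divide_distrib)
qed

text \<open>The pointwise infimum of a minimizing sequence of majorants attains the least
  expectation. Minimality follows because the minimum of \<open>h\<close> with another majorant is
  again a competitor and cannot have smaller expectation.\<close>

lemma (in prob_space) minimal_measurable_majorant:
  fixes g :: "'a \<Rightarrow> real"
  assumes bd: "\<And>z. z \<in> space M \<Longrightarrow> \<bar>g z\<bar> \<le> C"
  obtains h where "h \<in> borel_measurable M" "\<And>z. z \<in> space M \<Longrightarrow> g z \<le> h z" "\<And>z. z \<in> space M \<Longrightarrow> \<bar>h z\<bar> \<le> C"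
    "\<And>H. integrable M H \<Longrightarrow> AE z in M. g z \<le> H z \<Longrightarrow> AE z in M. h z \<le> H z"
proof -
  define S where "S = {h \<in> borel_measurable M. \<forall>z\<in>space M. g z \<le> h z \<and> \<bar>h z\<bar> \<le> C}"
  have S_int: "integrable M h" if "h \<in> S" for h
    using that by (intro integrable_const_bound[where B=C]) (auto simp: S_def)
  have "(\<lambda>_. C) \<in> S" using bd by (fastforce simp: S_def abs_le_iff)
  then have ne: "S \<noteq> {}" by auto
  have bdd: "bdd_below (expectation ` S)"
  proof (rule bdd_belowI2)
    fix h assume h: "h \<in> S"
    have "(\<integral>z. - C \<partial>M) \<le> expectation h"
      using S_int[OF h] h by (intro integral_mono) (fastforce simp: S_def abs_le_iff)+
    then show "- C \<le> expectation h" by (simp add: prob_space)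
  qed
  define m where "m = (INF h\<in>S. expectation h)"
  have "\<exists>h\<in>S. expectation h < m + 1 / real (Suc n)" for n
    using cINF_less_iff[OF ne bdd, of "m + 1 / real (Suc n)"] by (simp add: m_def)
  then obtain hs where hs: "\<And>n. hs n \<in> S" "\<And>n. expectation (hs n) < m + 1 / real (Suc n)"
    by metis
  define h where "h z = (INF n. hs n z)" for z
  have hs_bd: "g z \<le> hs n z" "\<bar>hs n z\<bar> \<le> C" if "z \<in> space M" for n z
    using hs(1)[of n] that by (auto simp: S_def)
  have bddz: "bdd_below (range (\<lambda>n. hs n z))" if "z \<in> space M" for z
    using hs_bd[OF that] by (intro bdd_belowI2[of _ "g z"]) auto
  have h_le: "h z \<le> hs n z" if "z \<in> space M" for z n
    unfolding h_def using bddz[OF that] by (intro cINF_lower) auto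
  have h_ge: "g z \<le> h z" "- C \<le> h z" if "z \<in> space M" for z
    unfolding h_def using hs_bd[OF that] by (auto intro!: cINF_greatest simp: abs_le_iff) (smt (verit))
  have [measurable]: "\<And>n. hs n \<in> borel_measurable M" using hs(1) by (auto simp: S_def)
  have hS: "h \<in> S"
    unfolding S_def
  proof (safe)
    show "h \<in> borel_measurable M" unfolding h_def using bddz by measurable
    fix z assume z: "z \<in> space M"
    show "g z \<le> h z" using h_ge z by simp
    show "\<bar>h z\<bar> \<le> C" using h_ge(2)[OF z] h_le[OF z, of 0] hs_bd(2)[OF z, of 0] by linarith
  qed
  have h_min: "expectation h \<le> m"
  proof (rule field_le_epsilon)
    fix e :: real assume "e > 0"
    then obtain n where n: "1 / real (Suc n) < e" using nat_approx_posE by blast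
    have "expectation h \<le> expectation (hs n)"
      using h_le S_int[OF hS] S_int[OF hs(1)] by (intro integral_mono) auto
    with hs(2)[of n] n show "expectation h \<le> m + e" by linarith
  qed
  show thesis
  proof (rule that[of h])
    fix H assume H: "integrable M H" and ae: "AE z in M. g z \<le> H z"
    then obtain N where N: "N \<in> null_sets M" "{z \<in> space M. \<not> g z \<le> H z} \<subseteq> N"
      unfolding eventually_ae_filter by auto
    have [measurable]: "H \<in> borel_measurable M" "h \<in> borel_measurable M" "N \<in> sets M"
      using H hS N by (auto simp: S_def)
    \<comment> \<open>\<open>H\<close> dominates \<open>g\<close> only off the null set
      \<open>N\<close>; keeping \<open>h\<close> there makes \<open>h'\<close> a majorant at every
      point, as membership in \<open>S\<close> demands.\<close>
    define h' where "h' z = (if z \<in> N then h z else min (h z) (H z))" for z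
    have h'_bd: "g z \<le> h' z" "h' z \<le> h z" if "z \<in> space M" for z
      using hS N(2) that by (auto simp: S_def h'_def)
    have "h' \<in> S"
    proof -
      have "h' \<in> borel_measurable M" unfolding h'_def by measurable
      moreover have "\<bar>h' z\<bar> \<le> C" if "z \<in> space M" for z
        using h'_bd[OF that] bd[OF that] hS that by (fastforce simp: S_def abs_le_iff)
      ultimately show ?thesis using h'_bd by (auto simp: S_def)
    qed
    then have "m \<le> expectation h'" unfolding m_def using bdd by (intro cINF_lower) auto
    then have "expectation (\<lambda>z. h z - h' z) \<le> 0"
      using h_min S_int[OF hS] S_int[OF \<open>h' \<in> S\<close>] by simp
    moreover have nn: "AE z in M. 0 \<le> h z - h' z" using h'_bd by auto
    ultimately have "expectation (\<lambda>z. h z - h' z) = 0"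
      by (simp add: integral_nonneg_AE order_antisym)
    then have "AE z in M. h z - h' z = 0"
      using integral_nonneg_eq_0_iff_AE[OF _ nn] S_int[OF hS] S_int[OF \<open>h' \<in> S\<close>] by simp
    moreover have "AE z in M. z \<notin> N" using N(1) by (rule AE_not_in)
    ultimately show "AE z in M. h z \<le> H z"
      by eventually_elim (auto simp: h'_def split: if_splits)
  qed (use hS in \<open>auto simp: S_def\<close>)
qed

text \<open>The function \<open>g\<close> need not be measurable. A minimal measurable majorant inherits bounded differences
  almost everywhere, because shifting one of its coordinates and adding \<open>c\<close> gives another majorant.\<close>
lemma (in product_prob_space) McDiarmid_outer:
  fixes g :: "('i \<Rightarrow> 'a) \<Rightarrow> real"
  assumes J: "finite J" "J \<noteq> {}" and bd: "\<And>z. z \<in> space (PiM J M) \<Longrightarrow> \<bar>g z\<bar> \<le> C"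
    and diff: "\<And>z i w. z \<in> space (PiM J M) \<Longrightarrow> i \<in> J \<Longrightarrow> w \<in> space (M i) \<Longrightarrow> g z \<le> g (z(i := w)) + c"
    and c: "c > 0" and x: "x > 0"
    and H: "integrable (PiM J M) H" "AE z in PiM J M. g z \<le> H z"
  obtains E where "E \<in> sets (PiM J M)"
    "measure (PiM J M) E \<ge> 1 - exp (- 2 * x\<^sup>2 / (real (card J) * c\<^sup>2))"
    "\<And>z. z \<in> E \<Longrightarrow> g z \<le> (\<integral>z. H z \<partial>PiM J M) + x"
proof -
  interpret PI: prob_space "PiM J M" by (rule prob_space_PiM) (rule prob_space)
  obtain h where h: "h \<in> borel_measurable (PiM J M)" "\<And>z. z \<in> space (PiM J M) \<Longrightarrow> g z \<le> h z"
    "\<And>z. z \<in> space (PiM J M) \<Longrightarrow> \<bar>h z\<bar> \<le> C"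
    "\<And>H. integrable (PiM J M) H \<Longrightarrow> AE z in PiM J M. g z \<le> H z \<Longrightarrow> AE z in PiM J M. h z \<le> H z"
    by (rule PI.minimal_measurable_majorant[of g C, OF bd]) (use that in blast)+
  note [measurable] = h(1)
  have h_int: "integrable (PiM J M) h"
    using h by (intro PI.integrable_const_bound[where B=C]) auto
  have osc: "AE z in PiM J M. AE w in M i. h z \<le> h (z(i := w)) + c" if i: "i \<in> J" for i
  proof -
    interpret P: pair_sigma_finite "M i" "PiM J M" ..
    have upd: "z(i := w) \<in> space (PiM J M)" if "z \<in> space (PiM J M)" "w \<in> space (M i)" for z w
      using that i by (auto simp: space_PiM PiE_iff extensional_def)
    have [measurable]: "(\<lambda>p. (snd p)(i := fst p)) \<in> M i \<Otimes>\<^sub>M PiM J M \<rightarrow>\<^sub>M PiM J M"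
      using i by (intro measurable_fun_upd[where J=J]) auto
    \<comment> \<open>Minimality works for one fixed shift \<open>w\<close> at a time, so
      \<open>w\<close> is quantified first; the order wanted by
      \<open>mgf_bounded_differences\<close> is recovered afterwards.\<close>
    have "AE w in M i. AE z in PiM J M. h z \<le> h (z(i := w)) + c"
    proof (rule AE_I2, rule h(4))
      fix w assume w: "w \<in> space (M i)"
      have [measurable]: "(\<lambda>z. z(i := w)) \<in> PiM J M \<rightarrow>\<^sub>M PiM J M"
        using i w by (intro measurable_fun_upd[where J=J]) auto
      have "\<bar>h (z(i := w)) + c\<bar> \<le> C + c" if "z \<in> space (PiM J M)" for z
        using h(3)[OF upd[OF that w]] c by linarith
      then show "integrable (PiM J M) (\<lambda>z. h (z(i := w)) + c)"
        by (intro PI.integrable_const_bound[where B="C + c"]) auto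
      have "g z \<le> h (z(i := w)) + c" if "z \<in> space (PiM J M)" for z
        using diff[OF that i w] h(2)[OF upd[OF that w]] by linarith
      then show "AE z in PiM J M. g z \<le> h (z(i := w)) + c" by auto
    qed
    then show ?thesis by (subst (asm) P.AE_commute) auto
  qed
  define n where "n = real (card J)"
  define \<mu> where "\<mu> = (\<integral>z. h z \<partial>PiM J M)"
  have n: "n > 0" using J by (simp add: n_def card_gt_0_iff)
  \<comment> \<open>Minimizer of the Chernoff exponent
    \<open>n * l^2 * c^2 / 8 - l * x\<close>.\<close>
  define l where "l = 4 * x / (n * c\<^sup>2)"
  have l: "l > 0" using n c x by (simp add: l_def)
  have mgf: "(\<integral>z. exp (l * h z) \<partial>PiM J M) \<le> exp (l * \<mu> + n * (l\<^sup>2 * c\<^sup>2 / 8))"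
    unfolding \<mu>_def n_def using h c l osc J by (intro mgf_bounded_differences[where C=C]) auto
  \<comment> \<open>Minimality is used a second time: the unknown mean of \<open>h\<close> is
    controlled by any integrable majorant \<open>H\<close>, in particular by one produced by
    symmetrization.\<close>
  have \<mu>_le: "\<mu> \<le> (\<integral>z. H z \<partial>PiM J M)"
    unfolding \<mu>_def using h(4)[OF H] H h_int by (intro integral_mono_AE) auto
  have int_exp: "integrable (PiM J M) (\<lambda>z. exp (l * h z))"
  proof (rule PI.integrable_const_bound[where B="exp (l * C)"])
    show "AE z in PiM J M. norm (exp (l * h z)) \<le> exp (l * C)"
      using h(3) l by (auto simp: abs_le_iff)
  qed measurable
  have "measure (PiM J M) {z \<in> space (PiM J M). exp (l * h z) \<ge> exp (l * (\<mu> + x))}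
      \<le> (\<integral>z. exp (l * h z) \<partial>PiM J M) / exp (l * (\<mu> + x))"
    using int_exp by (intro integral_Markov_inequality_measure[where A="{}"]) auto
  also have "\<dots> \<le> exp (l * \<mu> + n * (l\<^sup>2 * c\<^sup>2 / 8)) / exp (l * (\<mu> + x))"
    using mgf by (intro divide_right_mono) auto
  also have "\<dots> = exp (n * (l\<^sup>2 * c\<^sup>2 / 8) - l * x)"
    by (simp add: exp_diff[symmetric] algebra_simps)
  also have "n * (l\<^sup>2 * c\<^sup>2 / 8) - l * x = - 2 * x\<^sup>2 / (n * c\<^sup>2)"
    using n c by (simp add: l_def field_simps power2_eq_square)
  finally have bad: "measure (PiM J M) {z \<in> space (PiM J M). exp (l * h z) \<ge> exp (l * (\<mu> + x))} \<le> exp (- 2 * x\<^sup>2 / (n * c\<^sup>2))" .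
  let ?B = "{z \<in> space (PiM J M). exp (l * h z) \<ge> exp (l * (\<mu> + x))}"
  show thesis
  proof (rule that[of "space (PiM J M) - ?B"])
    show "measure (PiM J M) (space (PiM J M) - ?B) \<ge> 1 - exp (- 2 * x\<^sup>2 / (real (card J) * c\<^sup>2))"
      using bad by (subst PI.prob_compl) (auto simp: n_def)
    fix z assume z: "z \<in> space (PiM J M) - ?B"
    then have "h z < \<mu> + x" using l by (auto simp: not_le)
    then show "g z \<le> (\<integral>z. H z \<partial>PiM J M) + x" using h(2)[of z] z \<mu>_le by auto
  qed measurable
qed

subsection \<open>Symmetrization and contraction of measurable majorants\<close>

text \<open>A sign vector is encoded by the set of its positive coordinates, so that averages over
  Rademacher signs become sums over a power set.\<close>
definition sg :: "'i set \<Rightarrow> 'i \<Rightarrow> real" where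
  "sg S i = (if i \<in> S then 1 else -1)"

lemma sum_Pow_split:
  fixes g :: "'i set \<Rightarrow> real"
  assumes "finite J" "i \<in> J"
  shows "(\<Sum>S\<in>Pow J. g S) = (\<Sum>S\<in>Pow (J - {i}). g (insert i S) + g S)"
proof -
  have J: "J = insert i (J - {i})" using assms by auto
  have "(\<Sum>S\<in>Pow J. g S) = (\<Sum>S\<in>Pow (J - {i}). g S) + (\<Sum>S\<in>insert i ` Pow (J - {i}). g S)"
    by (subst J, subst Pow_insert, subst sum.union_disjoint) (use assms in auto)
  also have "(\<Sum>S\<in>insert i ` Pow (J - {i}). g S) = (\<Sum>S\<in>Pow (J - {i}). g (insert i S))"
    by (subst sum.reindex) (auto simp: inj_on_def)
  finally show ?thesis by (simp add: sum.distrib)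
qed

lemma sum_Pow_compl:
  fixes g :: "'i set \<Rightarrow> 'b::comm_monoid_add"
  shows "(\<Sum>S\<in>Pow J. g (J - S)) = (\<Sum>S\<in>Pow J. g S)"
  by (rule sum.reindex_bij_witness[where i="\<lambda>S. J - S" and j="\<lambda>S. J - S"]) auto

text \<open>\<open>T\<close> collects the coordinates already contracted, and the induction adds one
  at a time. Preservation of the total integral takes the place of the usual comparison of expected
  suprema. \<open>\<psi>\<close> may depend on the sample point \<open>z\<close>, as a loss does
  through its label.\<close>

lemma contraction_majorants_aux:
  fixes a :: "'f \<Rightarrow> 'z \<Rightarrow> 'i \<Rightarrow> real" and \<psi> :: "'i \<Rightarrow> 'z \<Rightarrow> real \<Rightarrow> real"
  assumes J: "finite J" and T: "T \<subseteq> J"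
    and U: "\<And>S. S \<subseteq> J \<Longrightarrow> integrable Q (U S)"
    and maj: "AE z in Q. \<forall>f\<in>F. \<forall>S. S \<subseteq> J \<longrightarrow> (\<Sum>i\<in>J. sg S i * a f z i) \<le> U S z"
    and lip: "\<And>i z s t. i \<in> J \<Longrightarrow> z \<in> space Q \<Longrightarrow> \<bar>\<psi> i z s - \<psi> i z t\<bar> \<le> \<bar>s - t\<bar>"
    and zero: "\<And>i z. i \<in> J \<Longrightarrow> z \<in> space Q \<Longrightarrow> \<psi> i z 0 = 0"
    and meas: "\<And>i t. i \<in> J \<Longrightarrow> t \<in> borel_measurable Q \<Longrightarrow> (\<lambda>z. \<psi> i z (t z)) \<in> borel_measurable Q"
  shows "\<exists>V. (\<forall>S\<subseteq>J. integrable Q (V S)) \<and>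
    (AE z in Q. \<forall>f\<in>F. \<forall>S. S \<subseteq> J \<longrightarrow>
      (\<Sum>i\<in>J. sg S i * (if i \<in> T then \<psi> i z (a f z i) else a f z i)) \<le> V S z) \<and>
    (\<Sum>S\<in>Pow J. \<integral>z. V S z \<partial>Q) = (\<Sum>S\<in>Pow J. \<integral>z. U S z \<partial>Q)"
  using finite_subset[OF T J] T
proof (induction T rule: finite_induct)
  case empty
  then show ?case using U maj by (intro exI[of _ U]) auto
next
  case (insert i T)
  then have i: "i \<in> J" by auto
  from insert obtain V where V: "\<And>S. S \<subseteq> J \<Longrightarrow> integrable Q (V S)"
    and V_maj: "AE z in Q. \<forall>f\<in>F. \<forall>S. S \<subseteq> J \<longrightarrow>
      (\<Sum>i\<in>J. sg S i * (if i \<in> T then \<psi> i z (a f z i) else a f z i)) \<le> V S z"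
    and V_sum: "(\<Sum>S\<in>Pow J. \<integral>z. V S z \<partial>Q) = (\<Sum>S\<in>Pow J. \<integral>z. U S z \<partial>Q)"
    by auto
  \<comment> \<open>If \<open>R + a \<le> V\<^sub>+\<close> and \<open>R - a \<le> V\<^sub>-\<close> then \<open>R + \<bar>a - d\<bar> \<le> m\<close>, where \<open>m\<close> and \<open>d\<close> are half the sum and
    half the difference of \<open>V\<^sub>+\<close> and \<open>V\<^sub>-\<close>. Hence \<open>m \<plusminus> \<psi> d\<close> are again majorants, they are measurable,
    and their sum is unchanged.\<close>
  define m where "m S z = (V (insert i S) z + V (S - {i}) z) / 2" for S z
  define d where "d S z = (V (insert i S) z - V (S - {i}) z) / 2" for S z
  define W where "W S z = m S z + sg S i * \<psi> i z (d S z)" for S z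
  have int_m: "integrable Q (m S)" and int_d: "integrable Q (d S)" if "S \<subseteq> J" for S
  proof -
    have "insert i S \<subseteq> J" "S - {i} \<subseteq> J" using that i by auto
    from this[THEN V] show "integrable Q (m S)" "integrable Q (d S)"
      unfolding m_def d_def by auto
  qed
  have int_\<psi>: "integrable Q (\<lambda>z. \<psi> i z (d S z))" if "S \<subseteq> J" for S
  proof (rule Bochner_Integration.integrable_bound[OF int_d[OF that]])
    show "(\<lambda>z. \<psi> i z (d S z)) \<in> borel_measurable Q"
      using int_d[OF that] by (intro meas[OF i]) auto
    show "AE z in Q. norm (\<psi> i z (d S z)) \<le> norm (d S z)"
      using lip[OF i, of _ _ 0] zero[OF i] by (intro AE_I2) simp
  qed
  have "integrable Q (W S)" if "S \<subseteq> J" for S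
    unfolding W_def using int_m[OF that] int_\<psi>[OF that] by simp
  moreover have "AE z in Q. \<forall>f\<in>F. \<forall>S. S \<subseteq> J \<longrightarrow>
      (\<Sum>j\<in>J. sg S j * (if j \<in> insert i T then \<psi> j z (a f z j) else a f z j)) \<le> W S z"
    using V_maj
  proof (rule AE_mp_space, intro ballI allI impI)
    fix z f S assume z: "z \<in> space Q" and f: "f \<in> F" and S: "S \<subseteq> J"
      and *: "\<forall>f\<in>F. \<forall>S. S \<subseteq> J \<longrightarrow>
      (\<Sum>i\<in>J. sg S i * (if i \<in> T then \<psi> i z (a f z i) else a f z i)) \<le> V S z"
    \<comment> \<open>The part of the signed sum that does not see the sign of coordinate
      \<open>i\<close>, hence common to the patterns \<open>insert i S\<close> and
      \<open>S - {i}\<close>.\<close>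
    define R where "R = (\<Sum>j\<in>J - {i}. sg S j * (if j \<in> T then \<psi> j z (a f z j) else a f z j))"
    have eq: "(\<Sum>j\<in>J. sg S' j * (if j \<in> T then \<psi> j z (a f z j) else a f z j)) = R + sg S' i * a f z i"
      if "S' = insert i S \<or> S' = S - {i}" for S'
    proof -
      have "(\<Sum>j\<in>J - {i}. sg S' j * (if j \<in> T then \<psi> j z (a f z j) else a f z j)) = R"
        unfolding R_def using that by (intro sum.cong) (auto simp: sg_def)
      then show ?thesis using insert.hyps by (subst sum.remove[OF J i]) auto
    qed
    have "R + a f z i \<le> V (insert i S) z"
      using *[rule_format, OF f, of "insert i S"] S i eq[of "insert i S"] by (simp add: sg_def)
    moreover have "R - a f z i \<le> V (S - {i}) z"
      using *[rule_format, OF f, of "S - {i}"] S i eq[of "S - {i}"] by (auto simp: sg_def)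
    ultimately have "R + \<bar>a f z i - d S z\<bar> \<le> m S z"
      unfolding d_def m_def by (simp add: abs_if field_simps)
    moreover have "sg S i * (\<psi> i z (a f z i) - \<psi> i z (d S z)) \<le> \<bar>a f z i - d S z\<bar>"
      using lip[OF i z, of "a f z i" "d S z"] by (auto simp: sg_def abs_le_iff)
    moreover have "(\<Sum>j\<in>J. sg S j * (if j \<in> insert i T then \<psi> j z (a f z j) else a f z j)) = R + sg S i * \<psi> i z (a f z i)"
      unfolding R_def by (subst sum.remove[OF J i]) (auto intro!: sum.cong)
    ultimately show "(\<Sum>j\<in>J. sg S j * (if j \<in> insert i T then \<psi> j z (a f z j) else a f z j)) \<le> W S z"
      unfolding W_def by (simp add: algebra_simps)
  qed
  moreover have "(\<Sum>S\<in>Pow J. \<integral>z. W S z \<partial>Q) = (\<Sum>S\<in>Pow J. \<integral>z. U S z \<partial>Q)"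
  proof -
    have "(\<integral>z. W (insert i S) z \<partial>Q) + (\<integral>z. W S z \<partial>Q) = (\<integral>z. V (insert i S) z \<partial>Q) + (\<integral>z. V S z \<partial>Q)"
      if S: "S \<in> Pow (J - {i})" for S
    proof -
      have S': "S \<subseteq> J" "insert i S \<subseteq> J" "S - {i} = S" "i \<notin> S" using S i by auto
      have "W (insert i S) = (\<lambda>z. m S z + \<psi> i z (d S z))"
        using S' by (simp add: fun_eq_iff W_def m_def d_def sg_def)
      then have 1: "(\<integral>z. W (insert i S) z \<partial>Q) = (\<integral>z. m S z \<partial>Q) + (\<integral>z. \<psi> i z (d S z) \<partial>Q)"
        using int_m[OF S'(1)] int_\<psi>[OF S'(1)] by simp
      have 2: "(\<integral>z. W S z \<partial>Q) = (\<integral>z. m S z \<partial>Q) - (\<integral>z. \<psi> i z (d S z) \<partial>Q)"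
        unfolding W_def using int_m[OF S'(1)] int_\<psi>[OF S'(1)] S' by (simp add: sg_def)
      have 3: "(\<integral>z. m S z \<partial>Q) = ((\<integral>z. V (insert i S) z \<partial>Q) + (\<integral>z. V S z \<partial>Q)) / 2"
        unfolding m_def using V S' by simp
      from 1 2 3 show ?thesis by simp
    qed
    then show ?thesis
      unfolding V_sum[symmetric] sum_Pow_split[OF J i] by (intro sum.cong) auto
  qed
  ultimately show ?case by (intro exI[of _ W]) auto
qed

text \<open>Reduction to Lipschitz constant 1: the values \<open>\<Lambda> * a\<close> are
  contracted by the map sending \<open>t\<close> to \<open>\<psi> (t / \<Lambda>)\<close>.\<close>

lemma contraction_majorants:
  fixes a :: "'f \<Rightarrow> 'z \<Rightarrow> 'i \<Rightarrow> real" and \<psi> :: "'i \<Rightarrow> 'z \<Rightarrow> real \<Rightarrow> real"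
  assumes J: "finite J" and \<Lambda>: "\<Lambda> > 0"
    and U: "\<And>S. S \<subseteq> J \<Longrightarrow> integrable Q (U S)"
    and maj: "AE z in Q. \<forall>f\<in>F. \<forall>S. S \<subseteq> J \<longrightarrow> (\<Sum>i\<in>J. sg S i * a f z i) \<le> U S z"
    and lip: "\<And>i z s t. i \<in> J \<Longrightarrow> z \<in> space Q \<Longrightarrow> \<bar>\<psi> i z s - \<psi> i z t\<bar> \<le> \<Lambda> * \<bar>s - t\<bar>"
    and zero: "\<And>i z. i \<in> J \<Longrightarrow> z \<in> space Q \<Longrightarrow> \<psi> i z 0 = 0"
    and meas: "\<And>i t. i \<in> J \<Longrightarrow> t \<in> borel_measurable Q \<Longrightarrow> (\<lambda>z. \<psi> i z (t z)) \<in> borel_measurable Q"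
  obtains V where "\<And>S. S \<subseteq> J \<Longrightarrow> integrable Q (V S)"
    "AE z in Q. \<forall>f\<in>F. \<forall>S. S \<subseteq> J \<longrightarrow> (\<Sum>i\<in>J. sg S i * \<psi> i z (a f z i)) \<le> V S z"
    "(\<Sum>S\<in>Pow J. \<integral>z. V S z \<partial>Q) = \<Lambda> * (\<Sum>S\<in>Pow J. \<integral>z. U S z \<partial>Q)"
proof -
  have "\<exists>V. (\<forall>S\<subseteq>J. integrable Q (V S)) \<and>
    (AE z in Q. \<forall>f\<in>F. \<forall>S. S \<subseteq> J \<longrightarrow>
      (\<Sum>i\<in>J. sg S i * (if i \<in> J then \<psi> i z (\<Lambda> * a f z i / \<Lambda>) else \<Lambda> * a f z i)) \<le> V S z) \<and>
    (\<Sum>S\<in>Pow J. \<integral>z. V S z \<partial>Q) = (\<Sum>S\<in>Pow J. \<integral>z. \<Lambda> * U S z \<partial>Q)"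
  proof (rule contraction_majorants_aux[OF J order_refl, where \<psi>="\<lambda>i z t. \<psi> i z (t / \<Lambda>)"
        and a="\<lambda>f z i. \<Lambda> * a f z i"])
    show "AE z in Q. \<forall>f\<in>F. \<forall>S. S \<subseteq> J \<longrightarrow> (\<Sum>i\<in>J. sg S i * (\<Lambda> * a f z i)) \<le> \<Lambda> * U S z"
      using maj
    proof eventually_elim
      case (elim z)
      have "(\<Sum>i\<in>J. sg S i * (\<Lambda> * a f z i)) = \<Lambda> * (\<Sum>i\<in>J. sg S i * a f z i)" for S f
        by (simp add: sum_distrib_left mult.left_commute)
      then show ?case using elim \<Lambda> by simp
    qed
    fix i z s t assume "i \<in> J" "z \<in> space Q"
    from lip[OF this, of "s / \<Lambda>" "t / \<Lambda>"] show "\<bar>\<psi> i z (s / \<Lambda>) - \<psi> i z (t / \<Lambda>)\<bar> \<le> \<bar>s - t\<bar>"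
      using \<Lambda> by (simp add: diff_divide_distrib[symmetric])
  qed (use U zero meas in auto)
  then obtain V where V: "\<forall>S\<subseteq>J. integrable Q (V S)"
    "AE z in Q. \<forall>f\<in>F. \<forall>S. S \<subseteq> J \<longrightarrow>
      (\<Sum>i\<in>J. sg S i * (if i \<in> J then \<psi> i z (\<Lambda> * a f z i / \<Lambda>) else \<Lambda> * a f z i)) \<le> V S z"
    "(\<Sum>S\<in>Pow J. \<integral>z. V S z \<partial>Q) = (\<Sum>S\<in>Pow J. \<integral>z. \<Lambda> * U S z \<partial>Q)"
    by blast
  show thesis
  proof (rule that)
    have "(\<Sum>i\<in>J. sg S i * (if i \<in> J then \<psi> i z (\<Lambda> * a f z i / \<Lambda>) else \<Lambda> * a f z i))
      = (\<Sum>i\<in>J. sg S i * \<psi> i z (a f z i))" for S f z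
      using \<Lambda> by (intro sum.cong) auto
    with V(2) show "AE z in Q. \<forall>f\<in>F. \<forall>S. S \<subseteq> J \<longrightarrow> (\<Sum>i\<in>J. sg S i * \<psi> i z (a f z i)) \<le> V S z"
      by simp
    show "(\<Sum>S\<in>Pow J. \<integral>z. V S z \<partial>Q) = \<Lambda> * (\<Sum>S\<in>Pow J. \<integral>z. U S z \<partial>Q)"
      using V(3) by (simp add: sum_distrib_left)
  qed (use V(1) in auto)
qed

section \<open>Symmetrization with a ghost sample: \<open>swap_on J D\<close> and
  \<open>swap_on J (- D)\<close> are complementary mixtures of a sample and its copy\<close>

definition swap_on :: "'i set \<Rightarrow> 'i set \<Rightarrow> ('i \<Rightarrow> 'a) \<times> ('i \<Rightarrow> 'a) \<Rightarrow> 'i \<Rightarrow> 'a" where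
  "swap_on J D p = (\<lambda>i\<in>J. if i \<in> D then fst p i else snd p i)"

lemma swap_on_measurable [measurable]:
  "swap_on J D \<in> PiM J M \<Otimes>\<^sub>M PiM J M \<rightarrow>\<^sub>M PiM J M"
  unfolding swap_on_def
proof (rule measurable_restrict)
  fix i assume [measurable]: "i \<in> J"
  show "(\<lambda>p. if i \<in> D then fst p i else snd p i) \<in> PiM J M \<Otimes>\<^sub>M PiM J M \<rightarrow>\<^sub>M M i"
    by (cases "i \<in> D") simp_all
qed

text \<open>The preimage of a box is a product of two boxes, and in each coordinate one of the two
  factors is the whole space, of mass 1.\<close>

lemma (in product_prob_space) distr_swap_on:
  assumes J: "finite J"
  shows "distr (PiM J M \<Otimes>\<^sub>M PiM J M) (PiM J M) (swap_on J D) = PiM J M"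
proof (rule PiM_eqI[OF J])
  fix A assume A: "\<And>i. i \<in> J \<Longrightarrow> A i \<in> sets (M i)"
  interpret PJ: prob_space "PiM J M" by (rule prob_space_PiM) (rule prob_space)
  interpret F: finite_product_sigma_finite M J by standard fact
  have vim: "swap_on J D -` Pi\<^sub>E J A \<inter> space (PiM J M \<Otimes>\<^sub>M PiM J M) =
      Pi\<^sub>E J (\<lambda>i. if i \<in> D then A i else space (M i)) \<times> Pi\<^sub>E J (\<lambda>i. if i \<in> D then space (M i) else A i)"
    using A[THEN sets.sets_into_space]
    by (auto simp: swap_on_def space_pair_measure space_PiM PiE_iff extensional_def split: if_splits) blast+
  have "emeasure (distr (PiM J M \<Otimes>\<^sub>M PiM J M) (PiM J M) (swap_on J D)) (Pi\<^sub>E J A) =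
      emeasure (PiM J M) (Pi\<^sub>E J (\<lambda>i. if i \<in> D then A i else space (M i))) *
      emeasure (PiM J M) (Pi\<^sub>E J (\<lambda>i. if i \<in> D then space (M i) else A i))"
    using A J by (subst emeasure_distr) (auto simp: vim intro!: PJ.emeasure_pair_measure_Times sets_PiM_I_finite)
  also have "\<dots> = (\<Prod>i\<in>J. emeasure (M i) (if i \<in> D then A i else space (M i)) * emeasure (M i) (if i \<in> D then space (M i) else A i))"
    using A by (subst (1 2) F.measure_times) (auto simp: prod.distrib)
  also have "\<dots> = (\<Prod>i\<in>J. emeasure (M i) (A i))"
    by (intro prod.cong) (auto simp: M.emeasure_space_1)
  finally show "emeasure (distr (PiM J M \<Otimes>\<^sub>M PiM J M) (PiM J M) (swap_on J D)) (Pi\<^sub>E J A) = (\<Prod>i\<in>J. emeasure (M i) (A i))" .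
qed simp

lemma (in product_prob_space) PiM_component_integral:
  fixes f :: "'a \<Rightarrow> real"
  assumes i: "i \<in> J" and f: "integrable (M i) f"
  shows "integrable (PiM J M) (\<lambda>z. f (z i))"
    and "(\<integral>z. f (z i) \<partial>PiM J M) = (\<integral>x. f x \<partial>M i)"
proof -
  interpret JJ: product_prob_space M J ..
  have *: "distr (PiM J M) (M i) (\<lambda>z. z i) = M i" using i by (rule JJ.PiM_component)
  have "integrable (distr (PiM J M) (M i) (\<lambda>z. z i)) f" using f * by simp
  then show "integrable (PiM J M) (\<lambda>z. f (z i))"
    by (rule integrable_distr[rotated]) (use i in simp)
  have "(\<integral>x. f x \<partial>M i) = (\<integral>x. f x \<partial>distr (PiM J M) (M i) (\<lambda>z. z i))" using * by simp
  also have "\<dots> = (\<integral>z. f (z i) \<partial>PiM J M)"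
    using f i by (intro integral_distr) auto
  finally show "(\<integral>z. f (z i) \<partial>PiM J M) = (\<integral>x. f x \<partial>M i)" by simp
qed

text \<open>The means are integrals over a ghost sample, so a majorant of the differences between
  the two samples becomes, after integrating out the ghost, a majorant of the centred sums. The two
  samples enter with the opposite patterns \<open>S\<close> and \<open>J - S\<close>, which costs
  the factor 2.\<close>

lemma (in product_prob_space) symmetrization_majorant:
  fixes q :: "'f \<Rightarrow> 'i \<Rightarrow> 'a \<Rightarrow> real"
  assumes J: "finite J"
    and W: "\<And>S. S \<subseteq> J \<Longrightarrow> integrable (PiM J M) (W S)"
    and maj: "AE z in PiM J M. \<forall>f\<in>F. \<forall>S. S \<subseteq> J \<longrightarrow> (\<Sum>i\<in>J. sg S i * q f i (z i)) \<le> W S z"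
    and q: "\<And>f i. f \<in> F \<Longrightarrow> i \<in> J \<Longrightarrow> integrable (M i) (q f i)"
  obtains H where "integrable (PiM J M) H"
    "AE z in PiM J M. \<forall>f\<in>F. (\<Sum>i\<in>J. sg \<tau> i * (q f i (z i) - (\<integral>x. q f i x \<partial>M i))) \<le> H z"
    "(\<integral>z. H z \<partial>PiM J M) \<le> 2 / 2 ^ card J * (\<Sum>S\<in>Pow J. \<integral>z. W S z \<partial>PiM J M)"
proof -
  let ?Q = "PiM J M"
  interpret PJ: prob_space ?Q by (rule prob_space_PiM) (rule prob_space)
  interpret PP: pair_sigma_finite ?Q ?Q ..
  define w where "w S = (\<integral>z. W S z \<partial>?Q)" for S
  \<comment> \<open>The law of a pair of independent samples is invariant under swapping coordinates, so any single sign
    pattern can replace \<open>\<tau>\<close>; we pick one that is at most average.\<close>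
  obtain S where S: "S \<subseteq> J" and wS: "w S + w (J - S) \<le> 2 / 2 ^ card J * (\<Sum>S\<in>Pow J. w S)"
  proof (rule ccontr)
    assume "\<not> thesis"
    with that have "w S + w (J - S) > 2 / 2 ^ card J * (\<Sum>S\<in>Pow J. w S)" if "S \<in> Pow J" for S
      using that by (meson PowD not_le)
    then have "(\<Sum>S\<in>Pow J. 2 / 2 ^ card J * (\<Sum>S\<in>Pow J. w S)) < (\<Sum>S\<in>Pow J. w S + w (J - S))"
      using J by (intro sum_strict_mono) auto
    also have "\<dots> = 2 * (\<Sum>S\<in>Pow J. w S)"
      by (simp add: sum.distrib sum_Pow_compl)
    finally show False using J by (simp add: card_Pow)
  qed
  \<comment> \<open>Where \<open>\<tau>\<close> agrees with \<open>S\<close> the first copy keeps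
    the sign of \<open>S\<close>; elsewhere the copies are exchanged, which reverses the sign of
    their difference. The \<open>\<tau>\<close>-signed difference thus splits into an
    \<open>S\<close>-signed and a \<open>J - S\<close>-signed sum over the two mixtures.\<close>
  define D where "D = {i. sg \<tau> i = sg S i}"
  define \<Phi> where "\<Phi> p = W S (swap_on J D p) + W (J - S) (swap_on J (- D) p)" for p
  have int_W: "integrable (?Q \<Otimes>\<^sub>M ?Q) (\<lambda>p. W T (swap_on J E p))"
    and lint_W: "(\<integral>p. W T (swap_on J E p) \<partial>(?Q \<Otimes>\<^sub>M ?Q)) = w T" if "T \<subseteq> J" for T E
  proof -
    have "integrable (distr (?Q \<Otimes>\<^sub>M ?Q) ?Q (swap_on J E)) (W T)"
      using W[OF that] J by (simp add: distr_swap_on)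
    then show "integrable (?Q \<Otimes>\<^sub>M ?Q) (\<lambda>p. W T (swap_on J E p))"
      by (rule integrable_distr[rotated]) simp
    have "w T = (\<integral>z. W T z \<partial>distr (?Q \<Otimes>\<^sub>M ?Q) ?Q (swap_on J E))"
      unfolding w_def using J by (simp add: distr_swap_on)
    also have "\<dots> = (\<integral>p. W T (swap_on J E p) \<partial>(?Q \<Otimes>\<^sub>M ?Q))"
      using W[OF that] by (intro integral_distr) auto
    finally show "(\<integral>p. W T (swap_on J E p) \<partial>(?Q \<Otimes>\<^sub>M ?Q)) = w T" by simp
  qed
  have int_\<Phi>: "integrable (?Q \<Otimes>\<^sub>M ?Q) \<Phi>"
    unfolding \<Phi>_def using S by (intro Bochner_Integration.integrable_add int_W) auto
  define H where "H z = (\<integral>z'. \<Phi> (z, z') \<partial>?Q)" for z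
  have swap_AE: "AE p in ?Q \<Otimes>\<^sub>M ?Q. \<forall>f\<in>F. \<forall>S. S \<subseteq> J \<longrightarrow> (\<Sum>i\<in>J. sg S i * q f i (swap_on J E p i)) \<le> W S (swap_on J E p)" for E
    by (rule AE_distrD[where M'="?Q"], simp, subst distr_swap_on[OF J], rule maj)
  have "AE p in ?Q \<Otimes>\<^sub>M ?Q. \<forall>f\<in>F. (\<Sum>i\<in>J. sg \<tau> i * (q f i (fst p i) - q f i (snd p i))) \<le> \<Phi> p"
    using swap_AE[of D] swap_AE[of "- D"]
  proof eventually_elim
    case (elim p)
    show ?case
    proof
      fix f assume f: "f \<in> F"
      have "(\<Sum>i\<in>J. sg \<tau> i * (q f i (fst p i) - q f i (snd p i)))
          = (\<Sum>i\<in>J. sg S i * q f i (swap_on J D p i)) + (\<Sum>i\<in>J. sg (J - S) i * q f i (swap_on J (- D) p i))"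
        unfolding sum.distrib[symmetric]
        by (intro sum.cong) (auto simp: swap_on_def D_def sg_def split: if_splits)
      also have "\<dots> \<le> \<Phi> p"
        unfolding \<Phi>_def using elim f S by (intro add_mono) auto
      finally show "(\<Sum>i\<in>J. sg \<tau> i * (q f i (fst p i) - q f i (snd p i))) \<le> \<Phi> p" .
    qed
  qed
  from PP.AE_pair[OF this] PP.AE_integrable_fst'[OF int_\<Phi>]
  have H_maj: "AE z in ?Q. \<forall>f\<in>F. (\<Sum>i\<in>J. sg \<tau> i * (q f i (z i) - (\<integral>x. q f i x \<partial>M i))) \<le> H z"
  proof eventually_elim
    case (elim z)
    show ?case
    proof
      fix f assume f: "f \<in> F"
      note comp = PiM_component_integral[OF _ q[OF f]]
      have "(\<Sum>i\<in>J. sg \<tau> i * (q f i (z i) - (\<integral>x. q f i x \<partial>M i)))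
          = (\<integral>z'. (\<Sum>i\<in>J. sg \<tau> i * (q f i (z i) - q f i (z' i))) \<partial>?Q)"
        using comp by (subst Bochner_Integration.integral_sum) (auto intro!: sum.cong simp: PJ.prob_space)
      also have "\<dots> \<le> H z"
        unfolding H_def using comp elim f
        by (intro integral_mono_AE) (auto elim!: eventually_mono)
      finally show "(\<Sum>i\<in>J. sg \<tau> i * (q f i (z i) - (\<integral>x. q f i x \<partial>M i))) \<le> H z" .
    qed
  qed
  have "(\<integral>z. H z \<partial>?Q) = (\<integral>p. \<Phi> p \<partial>(?Q \<Otimes>\<^sub>M ?Q))"
    unfolding H_def by (rule PP.integral_fst'[OF int_\<Phi>])
  also have "\<dots> = w S + w (J - S)"
    unfolding \<Phi>_def using S by (subst Bochner_Integration.integral_add) (auto simp: int_W lint_W)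
  finally have "(\<integral>z. H z \<partial>?Q) \<le> 2 / 2 ^ card J * (\<Sum>S\<in>Pow J. w S)" using wS by simp
  moreover have "integrable ?Q H" unfolding H_def by (rule PP.integrable_fst'[OF int_\<Phi>])
  ultimately show thesis using H_maj by (intro that[of H]) (auto simp: w_def)
qed

section \<open>From random signs to sums over sign patterns, and analytic tools\<close>

lemma nn_integral_rademacher:
  "(\<integral>\<^sup>+s. f s \<partial>rademacher) = (f 1 + f (- 1)) / 2"
proof -
  have "(\<integral>\<^sup>+s. f s \<partial>rademacher) = (\<Sum>s\<in>{-1, 1}. f s) / 2"
    unfolding rademacher_def by (subst nn_integral_pmf_of_set) auto
  then show ?thesis by (simp add: add.commute)
qed

lemma sets_rademacher [measurable_cong]: "sets rademacher = sets (count_space UNIV)"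
  by (simp add: rademacher_def)

lemma space_rademacher [simp]: "space rademacher = UNIV"
  by (simp add: rademacher_def)

lemma prob_space_rademacher: "prob_space rademacher"
  unfolding rademacher_def by (rule measure_pmf.prob_space_axioms)

text \<open>Translates the expectation in \<open>rad_condition\<close> into the encoding by
  \<open>sg\<close>. In the induction, \<open>h'\<close> integrates out the data of the new
  coordinate and averages over its sign, leaving an integrand on the smaller product.\<close>

lemma (in product_prob_space) nn_integral_PiM_rademacher:
  assumes J: "finite J" and h: "h \<in> borel_measurable (PiM J (\<lambda>i. M i \<Otimes>\<^sub>M rademacher))"
  shows "(\<integral>\<^sup>+w. h w \<partial>PiM J (\<lambda>i. M i \<Otimes>\<^sub>M rademacher)) =
    (\<Sum>S\<in>Pow J. \<integral>\<^sup>+x. h (\<lambda>i\<in>J. (x i, sg S i)) \<partial>PiM J M) / 2 ^ card J"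
  using J h
proof (induction J arbitrary: h)
  case empty
  show ?case by (simp add: PiM_empty nn_integral_count_space_finite divide_ennreal_def)
next
  case (insert i J)
  note [measurable] = insert.prems
  let ?N = "\<lambda>i. M i \<Otimes>\<^sub>M rademacher"
  interpret R: prob_space rademacher by (rule prob_space_rademacher)
  have pN: "prob_space (?N i)" for i
    by (intro prob_space_pair prob_space prob_space_rademacher)
  interpret N: product_prob_space ?N J
    by (intro product_prob_spaceI pN)
  have [measurable]: "(\<lambda>p. (fst p)(i := snd p)) \<in> PiM J ?N \<Otimes>\<^sub>M ?N i \<rightarrow>\<^sub>M PiM (insert i J) ?N"
    by (rule measurable_fun_upd[where J=J]) auto
  have [measurable]: "(\<lambda>p. (fst p)(i := (snd p, s))) \<in> PiM J ?N \<Otimes>\<^sub>M M i \<rightarrow>\<^sub>M PiM (insert i J) ?N" for s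
    by (rule measurable_fun_upd[where J=J]) auto
  define h' where "h' X = (\<integral>\<^sup>+a. (h (X(i := (a, 1))) + h (X(i := (a, - 1)))) \<partial>M i) / 2" for X
  have [measurable]: "h' \<in> borel_measurable (PiM J ?N)"
    unfolding h'_def by measurable
  have sgm: "(\<lambda>x. \<lambda>j\<in>J'. (x j, sg S j)) \<in> PiM J' M \<rightarrow>\<^sub>M PiM J' ?N" for S J'
    by (rule measurable_restrict) simp
  have "(\<integral>\<^sup>+w. h w \<partial>PiM (insert i J) ?N) = (\<integral>\<^sup>+X. (\<integral>\<^sup>+p. h (X(i := p)) \<partial>?N i) \<partial>PiM J ?N)"
    by (rule N.product_nn_integral_insert[OF insert.hyps insert.prems])
  also have "\<dots> = (\<integral>\<^sup>+X. h' X \<partial>PiM J ?N)"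
  proof (rule nn_integral_cong)
    fix X assume X: "X \<in> space (PiM J ?N)"
    then have [measurable]: "(\<lambda>p. X(i := p)) \<in> ?N i \<rightarrow>\<^sub>M PiM (insert i J) ?N"
      by (intro measurable_fun_upd[where J=J]) auto
    have "(\<integral>\<^sup>+p. h (X(i := p)) \<partial>?N i) = (\<integral>\<^sup>+a. (\<integral>\<^sup>+s. h (X(i := (a, s))) \<partial>rademacher) \<partial>M i)"
      by (rule R.nn_integral_fst[symmetric]) measurable
    then show "(\<integral>\<^sup>+p. h (X(i := p)) \<partial>?N i) = h' X"
      unfolding h'_def nn_integral_rademacher divide_ennreal_def
      by (subst nn_integral_multc[symmetric]) auto
  qed
  also have "\<dots> = (\<Sum>S\<in>Pow J. \<integral>\<^sup>+x. h' (\<lambda>j\<in>J. (x j, sg S j)) \<partial>PiM J M) / 2 ^ card J"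
    by (rule insert.IH) simp
  also have "(\<Sum>S\<in>Pow J. \<integral>\<^sup>+x. h' (\<lambda>j\<in>J. (x j, sg S j)) \<partial>PiM J M)
      = (\<Sum>S\<in>Pow J. ((\<integral>\<^sup>+x. h (\<lambda>j\<in>insert i J. (x j, sg (insert i S) j)) \<partial>PiM (insert i J) M) +
                       (\<integral>\<^sup>+x. h (\<lambda>j\<in>insert i J. (x j, sg S j)) \<partial>PiM (insert i J) M)) / 2)"
  proof (rule sum.cong[OF refl])
    fix S assume "S \<in> Pow J"
    then have iS: "i \<notin> S" using insert.hyps by auto
    have upd: "(\<lambda>j\<in>insert i J. ((x(i := y)) j, sg (insert i S) j)) = (\<lambda>j\<in>J. (x j, sg S j))(i := (y, 1))"
      "(\<lambda>j\<in>insert i J. ((x(i := y)) j, sg S j)) = (\<lambda>j\<in>J. (x j, sg S j))(i := (y, - 1))" for x y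
      using iS insert.hyps by (auto simp: fun_eq_iff sg_def)
    have e: "(\<integral>\<^sup>+x. h (\<lambda>j\<in>insert i J. (x j, sg T j)) \<partial>PiM (insert i J) M) =
       (\<integral>\<^sup>+x. (\<integral>\<^sup>+y. h (\<lambda>j\<in>insert i J. ((x(i := y)) j, sg T j)) \<partial>M i) \<partial>PiM J M)" for T
      using measurable_compose[OF sgm insert.prems] by (rule product_nn_integral_insert[OF insert.hyps])
    note [measurable] = sgm
    have sec [measurable]: "(\<lambda>p. (\<lambda>j\<in>J. (fst p j, sg S j))(i := (snd p, s))) \<in> PiM J M \<Otimes>\<^sub>M M i \<rightarrow>\<^sub>M PiM (insert i J) ?N" for s
      by (rule measurable_fun_upd[where J=J]) auto
    have "(\<integral>\<^sup>+x. h' (\<lambda>j\<in>J. (x j, sg S j)) \<partial>PiM J M) =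
      (\<integral>\<^sup>+x. ((\<integral>\<^sup>+y. h ((\<lambda>j\<in>J. (x j, sg S j))(i := (y, 1))) \<partial>M i) + (\<integral>\<^sup>+y. h ((\<lambda>j\<in>J. (x j, sg S j))(i := (y, - 1))) \<partial>M i)) / 2 \<partial>PiM J M)"
      unfolding h'_def
      by (intro nn_integral_cong, subst nn_integral_add) auto
    also have "\<dots> = ((\<integral>\<^sup>+x. (\<integral>\<^sup>+y. h ((\<lambda>j\<in>J. (x j, sg S j))(i := (y, 1))) \<partial>M i) \<partial>PiM J M)
         + (\<integral>\<^sup>+x. (\<integral>\<^sup>+y. h ((\<lambda>j\<in>J. (x j, sg S j))(i := (y, - 1))) \<partial>M i) \<partial>PiM J M)) / 2"
      unfolding divide_ennreal_def by (subst nn_integral_multc, measurable, subst nn_integral_add) auto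
    finally show "(\<integral>\<^sup>+x. h' (\<lambda>j\<in>J. (x j, sg S j)) \<partial>PiM J M) =
       ((\<integral>\<^sup>+x. h (\<lambda>j\<in>insert i J. (x j, sg (insert i S) j)) \<partial>PiM (insert i J) M) +
        (\<integral>\<^sup>+x. h (\<lambda>j\<in>insert i J. (x j, sg S j)) \<partial>PiM (insert i J) M)) / 2"
      unfolding e upd .
  qed
  also have "\<dots> = (\<Sum>S\<in>Pow (insert i J). \<integral>\<^sup>+x. h (\<lambda>j\<in>insert i J. (x j, sg S j)) \<partial>PiM (insert i J) M) / 2"
  proof -
    have "insert i ` Pow J \<inter> Pow J = {}" "inj_on (insert i) (Pow J)"
      using insert.hyps by (auto simp: inj_on_def)
    then show ?thesis
      using insert.hyps(1) unfolding Pow_insert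
      by (subst Un_commute, subst sum.union_disjoint)
        (auto simp: sum.reindex divide_ennreal_def sum_distrib_right sum.distrib distrib_right)
  qed
  also have "a / 2 / 2 ^ card J = a / 2 ^ card (insert i J)" for a :: ennreal
    using insert.hyps by (simp add: divide_ennreal_def ennreal_inverse_mult' mult.assoc)
  finally show ?case .
qed

text \<open>McShane's extension formula, with the infimum taken over a countable dense subset of
  \<open>V\<close> only. Countability gives joint measurability, and Lipschitz continuity recovers
  the values on all of \<open>V\<close>.\<close>

lemma lipschitz_measurable_extension:
  fixes l :: "real \<Rightarrow> 'y \<Rightarrow> real"
  assumes V: "V \<noteq> {}" and L: "L \<ge> 0"
    and lip: "\<And>y u v. y \<in> space N \<Longrightarrow> u \<in> V \<Longrightarrow> v \<in> V \<Longrightarrow> \<bar>l u y - l v y\<bar> \<le> L * \<bar>u - v\<bar>"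
    and meas: "\<And>v. v \<in> V \<Longrightarrow> l v \<in> borel_measurable N"
  obtains l' where "(\<lambda>p. l' (fst p) (snd p)) \<in> borel_measurable (borel \<Otimes>\<^sub>M N)"
    "\<And>y u v. y \<in> space N \<Longrightarrow> \<bar>l' u y - l' v y\<bar> \<le> L * \<bar>u - v\<bar>"
    "\<And>y u. y \<in> space N \<Longrightarrow> u \<in> V \<Longrightarrow> l' u y = l u y"
proof -
  obtain D where D: "countable D" "D \<subseteq> V" "V \<subseteq> closure D" by (rule separable)
  have "D \<noteq> {}" using D(3) V by auto
  then obtain v0 where v0: "v0 \<in> D" by auto
  define l' where "l' u y = (INF v\<in>D. l v y + L * \<bar>u - v\<bar>)" for u y
  have lower: "l v0 y - L * \<bar>v0 - u\<bar> \<le> l v y + L * \<bar>u - v\<bar>" if "y \<in> space N" "v \<in> D" for u v y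
  proof -
    have "\<bar>l v0 y - l v y\<bar> \<le> L * \<bar>v0 - v\<bar>" using lip that v0 D(2) by blast
    moreover have "L * \<bar>v0 - v\<bar> \<le> L * (\<bar>v0 - u\<bar> + \<bar>u - v\<bar>)" using L by (intro mult_left_mono) auto
    ultimately show ?thesis by (simp add: algebra_simps abs_le_iff)
  qed
  have bdd: "bdd_below ((\<lambda>v. l v y + L * \<bar>u - v\<bar>) ` D)" if "y \<in> space N" for u y
    using lower[OF that] by (intro bdd_belowI2) auto
  have half: "l' u y \<le> l' v y + L * \<bar>u - v\<bar>" if y: "y \<in> space N" for u v y
  proof -
    have "l' u y - L * \<bar>u - v\<bar> \<le> l' v y"
      unfolding l'_def[of v]
    proof (rule cINF_greatest[OF \<open>D \<noteq> {}\<close>])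
      fix w assume w: "w \<in> D"
      have "l' u y \<le> l w y + L * \<bar>u - w\<bar>"
        unfolding l'_def using bdd[OF y] w by (rule cINF_lower)
      also have "L * \<bar>u - w\<bar> \<le> L * (\<bar>u - v\<bar> + \<bar>v - w\<bar>)" using L by (intro mult_left_mono) auto
      finally show "l' u y - L * \<bar>u - v\<bar> \<le> l w y + L * \<bar>v - w\<bar>" by (simp add: algebra_simps)
    qed
    then show ?thesis by simp
  qed
  show thesis
  proof (rule that[of l'])
    show "(\<lambda>p. l' (fst p) (snd p)) \<in> borel_measurable (borel \<Otimes>\<^sub>M N)"
      unfolding l'_def
    proof (rule borel_measurable_cINF_real[OF D(1)])
      fix v assume "v \<in> D"
      then have [measurable]: "l v \<in> borel_measurable N" using meas D(2) by auto
      show "(\<lambda>p. l v (snd p) + L * \<bar>fst p - v\<bar>) \<in> borel_measurable (borel \<Otimes>\<^sub>M N)" by measurable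
    qed
    fix y u v assume y: "y \<in> space N"
    show "\<bar>l' u y - l' v y\<bar> \<le> L * \<bar>u - v\<bar>"
      using half[OF y, of u v] half[OF y, of v u] by (simp add: abs_le_iff abs_minus_commute)
  next
    fix y u assume y: "y \<in> space N" and u: "u \<in> V"
    show "l' u y = l u y"
    proof (rule antisym)
      show "l u y \<le> l' u y"
        unfolding l'_def
      proof (rule cINF_greatest[OF \<open>D \<noteq> {}\<close>])
        fix v assume "v \<in> D"
        then show "l u y \<le> l v y + L * \<bar>u - v\<bar>"
          using lip[OF y u, of v] D(2) by (auto simp: abs_le_iff)
      qed
      show "l' u y \<le> l u y"
      proof (rule field_le_epsilon)
        fix e :: real assume e: "e > 0"
        have "u \<in> closure D" using u D by auto
        \<comment> \<open>\<open>2 * L + 1\<close> instead of \<open>2 * L\<close>, since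
          \<open>L\<close> may be 0.\<close>
        moreover have "e / (2 * L + 1) > 0" using e L by simp
        ultimately obtain v where v: "v \<in> D" "dist v u < e / (2 * L + 1)"
          using closure_approachable by blast
        have "l' u y \<le> l v y + L * \<bar>u - v\<bar>"
          unfolding l'_def using bdd[OF y] v(1) by (rule cINF_lower)
        also have "l v y \<le> l u y + L * \<bar>u - v\<bar>"
          using lip[OF y u, of v] v D(2) by (auto simp: abs_le_iff)
        finally have "l' u y \<le> l u y + 2 * L * \<bar>u - v\<bar>" by simp
        also have "2 * L * \<bar>u - v\<bar> \<le> (2 * L + 1) * (e / (2 * L + 1))"
          using v(2) L by (intro mult_mono) (auto simp: dist_real_def)
        also have "\<dots> = e" using L by simp
        finally show "l' u y \<le> l u y + e" by simp
      qed
    qed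
  qed
qed

lemma (in product_prob_space) PiM_second_moment_sum:
  fixes a :: "'i \<Rightarrow> 'a \<Rightarrow> real"
  assumes J: "finite J"
    and a: "\<And>i. i \<in> J \<Longrightarrow> a i \<in> borel_measurable (M i)"
    and a2: "\<And>i. i \<in> J \<Longrightarrow> integrable (M i) (\<lambda>x. (a i x)\<^sup>2)"
    and a0: "\<And>i. i \<in> J \<Longrightarrow> (\<integral>x. a i x \<partial>M i) = 0"
  shows "integrable (PiM J M) (\<lambda>z. (\<Sum>i\<in>J. a i (z i))\<^sup>2)"
    and "(\<integral>z. (\<Sum>i\<in>J. a i (z i))\<^sup>2 \<partial>PiM J M) = (\<Sum>i\<in>J. \<integral>x. (a i x)\<^sup>2 \<partial>M i)"
proof -
  have a1: "integrable (M i) (a i)" if "i \<in> J" for i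
    using a[OF that] a2[OF that] by (rule M.square_integrable_imp_integrable)
  have cross: "integrable (PiM J M) (\<lambda>z. a i (z i) * a j (z j)) \<and>
      (\<integral>z. a i (z i) * a j (z j) \<partial>PiM J M) = (if i = j then (\<integral>x. (a i x)\<^sup>2 \<partial>M i) else 0)"
    if ij: "i \<in> J" "j \<in> J" for i j
  proof (cases "i = j")
    case True
    then show ?thesis using PiM_component_integral[OF ij(1) a2[OF ij(1)]] by (simp add: power2_eq_square)
  next
    case False
    \<comment> \<open>Padding with the constant 1 writes the cross term as a product over all of
      \<open>J\<close>, so it factorizes into integrals, one of which is the vanishing mean of
      \<open>a i\<close>.\<close>
    define f where "f k = (if k \<in> {i, j} then a k else (\<lambda>_. 1))" for k
    have f: "integrable (M k) (f k)" if "k \<in> J" for k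
      using a1[OF that] by (simp add: f_def)
    have pr: "(\<Prod>k\<in>J. g k) = g i * g j" if "\<And>k. k \<notin> {i, j} \<Longrightarrow> g k = 1" for g :: "'i \<Rightarrow> real"
    proof -
      have "(\<Prod>k\<in>J. g k) = (\<Prod>k\<in>{i, j}. g k)"
        using that ij J by (intro prod.mono_neutral_right) auto
      then show ?thesis using False by simp
    qed
    have e: "(\<Prod>k\<in>J. f k (z k)) = a i (z i) * a j (z j)" for z
      by (subst pr) (auto simp: f_def)
    have "integrable (PiM J M) (\<lambda>z. \<Prod>k\<in>J. f k (z k))"
      by (rule product_integrable_prod[OF J f])
    moreover have "(\<integral>z. (\<Prod>k\<in>J. f k (z k)) \<partial>PiM J M) = (\<Prod>k\<in>J. \<integral>x. f k x \<partial>M k)"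
      by (rule product_integral_prod[OF J f])
    moreover have "(\<Prod>k\<in>J. \<integral>x. f k x \<partial>M k) = 0"
      using a0[OF ij(1)] J ij by (intro prod_zero) (auto simp: f_def intro!: bexI[of _ i])
    ultimately show ?thesis using False by (simp add: e)
  qed
  have sq: "(\<Sum>i\<in>J. a i (z i))\<^sup>2 = (\<Sum>i\<in>J. \<Sum>j\<in>J. a i (z i) * a j (z j))" for z
    by (simp add: power2_eq_square sum_product)
  show "integrable (PiM J M) (\<lambda>z. (\<Sum>i\<in>J. a i (z i))\<^sup>2)"
    unfolding sq using cross by auto
  show "(\<integral>z. (\<Sum>i\<in>J. a i (z i))\<^sup>2 \<partial>PiM J M) = (\<Sum>i\<in>J. \<integral>x. (a i x)\<^sup>2 \<partial>M i)"
    unfolding sq using cross J by (simp add: Bochner_Integration.integral_sum sum.delta)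
qed

text \<open>A single measurable \<open>h\<close> that nearly attains the outer integral is evaluated
  at each sign pattern in turn, which gives the whole family. The slack \<open>b < b'\<close> is
  there because the infimum need not be attained; \<open>h\<close> may be infinite, but only on null
  sets for the finitely many patterns.\<close>

lemma (in product_prob_space) outer_rademacher_majorants:
  fixes d :: "'f \<Rightarrow> 'x \<Rightarrow> real" and p :: "'a \<Rightarrow> 'x"
  assumes J: "finite J" and p: "\<And>i. p \<in> M i \<rightarrow>\<^sub>M N"
    and outer: "outer_nn_integral (PiM J (\<lambda>i. distr (M i) N p \<Otimes>\<^sub>M rademacher))
        (\<lambda>w. SUP f\<in>G. ennreal \<bar>\<Sum>i\<in>J. snd (w i) * d f (fst (w i))\<bar>) \<le> ennreal b"
    and b: "0 \<le> b" "b < b'"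
  obtains U where "\<And>S. S \<subseteq> J \<Longrightarrow> integrable (PiM J M) (U S)"
    "AE z in PiM J M. \<forall>f\<in>G. \<forall>S. S \<subseteq> J \<longrightarrow> \<bar>\<Sum>i\<in>J. sg S i * d f (p (z i))\<bar> \<le> U S z"
    "(\<Sum>S\<in>Pow J. \<integral>z. U S z \<partial>PiM J M) \<le> 2 ^ card J * b'"
proof -
  let ?N = "\<lambda>i. distr (M i) N p"
  let ?NR = "PiM J (\<lambda>i. ?N i \<Otimes>\<^sub>M rademacher)"
  have pN: "prob_space (?N i)" for i using p prob_space by (intro prob_space.prob_space_distr) 
  interpret N: product_prob_space ?N J by (intro product_prob_spaceI pN)
  note [measurable] = p
  have "outer_nn_integral ?NR (\<lambda>w. SUP f\<in>G. ennreal \<bar>\<Sum>i\<in>J. snd (w i) * d f (fst (w i))\<bar>) < ennreal b'"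
    using outer b by (rule_tac le_less_trans[OF outer]) (simp add: ennreal_less_iff)
  then obtain h where h [measurable]: "h \<in> borel_measurable ?NR"
    and h_maj: "\<And>w. w \<in> space ?NR \<Longrightarrow> (SUP f\<in>G. ennreal \<bar>\<Sum>i\<in>J. snd (w i) * d f (fst (w i))\<bar>) \<le> h w"
    and h_int: "nn_integral ?NR h < ennreal b'"
    unfolding outer_nn_integral_def INF_less_iff by auto
  define e where "e S z = (\<lambda>i\<in>J. (p (z i), sg S i))" for S z
  have e [measurable]: "e S \<in> PiM J M \<rightarrow>\<^sub>M ?NR" for S
    unfolding e_def by (rule measurable_restrict) simp
  have e' [measurable]: "(\<lambda>x. \<lambda>i\<in>J. (x i, sg S i)) \<in> PiM J ?N \<rightarrow>\<^sub>M ?NR" for S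
    by (rule measurable_restrict) simp
  have c [measurable]: "compose J p \<in> PiM J M \<rightarrow>\<^sub>M PiM J ?N"
    unfolding compose_def by (rule measurable_restrict) simp
  \<comment> \<open>\<open>h\<close> lives on the image space of \<open>p\<close>, whereas the
    majorants must live on the full observations; they are pulled back coordinatewise.\<close>
  have hS: "(\<integral>\<^sup>+x. h (\<lambda>i\<in>J. (x i, sg S i)) \<partial>PiM J ?N) = (\<integral>\<^sup>+z. h (e S z) \<partial>PiM J M)" for S
  proof -
    have dd: "distr (M i) (?N i) p = ?N i" for i by (rule distr_cong) auto
    have "distr (PiM J M) (PiM J ?N) (compose J p) = PiM J (\<lambda>i. distr (M i) (?N i) p)"
      by (rule distr_PiM_finite_prob_space'[OF J prob_space pN]) simp
    then have eq: "PiM J ?N = distr (PiM J M) (PiM J ?N) (compose J p)"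
      by (simp only: dd)
    have e_eq: "(\<lambda>i\<in>J. (compose J p z i, sg S i)) = e S z" for z
      by (auto simp: e_def compose_def fun_eq_iff)
    have "(\<integral>\<^sup>+x. h (\<lambda>i\<in>J. (x i, sg S i)) \<partial>PiM J ?N) = (\<integral>\<^sup>+x. h (\<lambda>i\<in>J. (x i, sg S i)) \<partial>distr (PiM J M) (PiM J ?N) (compose J p))"
      by (rule arg_cong[OF eq])
    also have "\<dots> = (\<integral>\<^sup>+z. h (\<lambda>i\<in>J. (compose J p z i, sg S i)) \<partial>PiM J M)"
      by (rule nn_integral_distr) measurable
    finally show ?thesis by (simp only: e_eq)
  qed
  have total: "(\<Sum>S\<in>Pow J. \<integral>\<^sup>+z. h (e S z) \<partial>PiM J M) \<le> ennreal (2 ^ card J * b')"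
  proof -
    have "(\<Sum>S\<in>Pow J. \<integral>\<^sup>+z. h (e S z) \<partial>PiM J M) / 2 ^ card J \<le> ennreal b'"
      using N.nn_integral_PiM_rademacher[OF J h] h_int by (simp add: hS)
    then have "(\<Sum>S\<in>Pow J. \<integral>\<^sup>+z. h (e S z) \<partial>PiM J M) / 2 ^ card J * 2 ^ card J \<le> ennreal b' * 2 ^ card J"
      by (rule mult_right_mono) simp
    also have "(\<Sum>S\<in>Pow J. \<integral>\<^sup>+z. h (e S z) \<partial>PiM J M) / 2 ^ card J * 2 ^ card J = (\<Sum>S\<in>Pow J. \<integral>\<^sup>+z. h (e S z) \<partial>PiM J M)"
      by (simp add: ennreal_divide_times ennreal_divide_self power_less_top_ennreal)
    also have "ennreal b' * 2 ^ card J = ennreal (2 ^ card J * b')"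
      using b by (simp add: ennreal_mult ennreal_power[symmetric] mult.commute)
    finally show ?thesis .
  qed
  have fin: "(\<integral>\<^sup>+z. h (e S z) \<partial>PiM J M) < \<infinity>" if "S \<subseteq> J" for S
  proof -
    have "(\<integral>\<^sup>+z. h (e S z) \<partial>PiM J M) \<le> (\<Sum>S\<in>Pow J. \<integral>\<^sup>+z. h (e S z) \<partial>PiM J M)"
      using that J by (intro sum_nonneg_leq_bound[OF _ _ refl]) auto
    also note total
    also have "ennreal (2 ^ card J * b') < \<infinity>" by simp
    finally show ?thesis .
  qed
  define U where "U S z = enn2real (h (e S z))" for S z
  have AE_fin: "AE z in PiM J M. h (e S z) \<noteq> \<infinity>" if "S \<subseteq> J" for S
    using fin[OF that] by (intro nn_integral_noteq_infinite) auto
  have nn_U: "(\<integral>\<^sup>+z. ennreal (U S z) \<partial>PiM J M) = (\<integral>\<^sup>+z. h (e S z) \<partial>PiM J M)" if "S \<subseteq> J" for S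
    using AE_fin[OF that] by (intro nn_integral_cong_AE) (auto simp: U_def less_top elim!: eventually_mono)
  have int_U: "integrable (PiM J M) (U S)" if "S \<subseteq> J" for S
  proof (rule integrableI_nonneg)
    show "(\<integral>\<^sup>+z. ennreal (U S z) \<partial>PiM J M) < \<infinity>" using nn_U[OF that] fin[OF that] by simp
    show "U S \<in> borel_measurable (PiM J M)" unfolding U_def by measurable
  qed (simp add: U_def)
  show thesis
  proof (rule that[of U])
    have "AE z in PiM J M. \<forall>S\<in>Pow J. h (e S z) \<noteq> \<infinity>"
      using AE_fin J by (intro AE_finite_allI) auto
    then show "AE z in PiM J M. \<forall>f\<in>G. \<forall>S. S \<subseteq> J \<longrightarrow> \<bar>\<Sum>i\<in>J. sg S i * d f (p (z i))\<bar> \<le> U S z"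
    proof (rule AE_mp_space, intro ballI allI impI)
      fix z f S assume z: "z \<in> space (PiM J M)" and *: "\<forall>S\<in>Pow J. h (e S z) \<noteq> \<infinity>" and f: "f \<in> G" and S: "S \<subseteq> J"
      have "ennreal \<bar>\<Sum>i\<in>J. snd (e S z i) * d f (fst (e S z i))\<bar> \<le> h (e S z)"
        using h_maj[OF measurable_space[OF e z], of S] f by (auto simp: SUP_le_iff)
      also have "(\<Sum>i\<in>J. snd (e S z i) * d f (fst (e S z i))) = (\<Sum>i\<in>J. sg S i * d f (p (z i)))"
        by (intro sum.cong) (auto simp: e_def)
      also have "h (e S z) = ennreal (U S z)"
        using * S by (auto simp: U_def less_top)
      finally show "\<bar>\<Sum>i\<in>J. sg S i * d f (p (z i))\<bar> \<le> U S z"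
        by (simp add: U_def)
    qed
    have "ennreal (\<Sum>S\<in>Pow J. \<integral>z. U S z \<partial>PiM J M) = (\<Sum>S\<in>Pow J. \<integral>\<^sup>+z. h (e S z) \<partial>PiM J M)"
      using int_U nn_U by (subst sum_ennreal[symmetric])
        (auto intro!: sum.cong integral_nonneg simp: U_def nn_integral_eq_integral[symmetric])
    also note total
    finally show "(\<Sum>S\<in>Pow J. \<integral>z. U S z \<partial>PiM J M) \<le> 2 ^ card J * b'"
      using b by (subst (asm) ennreal_le_iff) auto
  qed (use int_U in auto)
qed

text \<open>Truncating before squaring gives the same function, and on [0,1] the square has slope at
  most 2.\<close>

lemma min_square_lipschitz:
  fixes a b :: real
  shows "\<bar>min 1 (a\<^sup>2) - min 1 (b\<^sup>2)\<bar> \<le> 2 * \<bar>a - b\<bar>"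
proof -
  define x y where "x = min 1 \<bar>a\<bar>" and "y = min 1 \<bar>b\<bar>"
  have sq: "min 1 (t\<^sup>2) = (min 1 \<bar>t\<bar>)\<^sup>2" for t :: real
  proof (cases "\<bar>t\<bar> \<le> 1")
    case True then show ?thesis using abs_square_le_1[of t] by (simp add: min_def)
  next
    case False then show ?thesis using abs_square_le_1[of t] by (simp add: min_def)
  qed
  have xy: "0 \<le> x" "x \<le> 1" "0 \<le> y" "y \<le> 1" "\<bar>x - y\<bar> \<le> \<bar>a - b\<bar>"
    by (auto simp: x_def y_def min_def abs_if)
  have "\<bar>x\<^sup>2 - y\<^sup>2\<bar> = \<bar>x - y\<bar> * (x + y)"
    using xy by (simp add: power2_eq_square square_diff_square_factored abs_mult)
  also have "\<dots> \<le> \<bar>a - b\<bar> * 2" using xy by (intro mult_mono) auto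
  finally show ?thesis unfolding sq x_def[symmetric] y_def[symmetric] by simp
qed

subsection \<open>Uniform control of blocks\<close>

text \<open>The preimage of a box of observations is a box of block boxes, because \<open>b\<close>
  recovers the block of an index. This links the product over blocks, where bounded differences are
  applied, to the product over observations, where the complexity is given.\<close>

lemma (in product_prob_space) distr_flatten_blocks:
  fixes B :: "'k \<Rightarrow> 'i set"
  assumes KK: "finite KK" "\<And>k. k \<in> KK \<Longrightarrow> finite (B k)" and b: "\<And>k i. k \<in> KK \<Longrightarrow> i \<in> B k \<Longrightarrow> b i = k"
  shows "(\<lambda>w. \<lambda>i\<in>(\<Union>k\<in>KK. B k). w (b i) i) \<in> PiM KK (\<lambda>k. PiM (B k) M) \<rightarrow>\<^sub>M PiM (\<Union>k\<in>KK. B k) M"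
    and "distr (PiM KK (\<lambda>k. PiM (B k) M)) (PiM (\<Union>k\<in>KK. B k) M) (\<lambda>w. \<lambda>i\<in>(\<Union>k\<in>KK. B k). w (b i) i)
      = PiM (\<Union>k\<in>KK. B k) M"
proof -
  let ?J = "\<Union>k\<in>KK. B k" and ?D = "\<lambda>k. PiM (B k) M"
  let ?fl = "\<lambda>w. \<lambda>i\<in>?J. w (b i) i"
  show meas [measurable]: "?fl \<in> PiM KK ?D \<rightarrow>\<^sub>M PiM ?J M"
  proof (rule measurable_restrict)
    fix i assume "i \<in> ?J"
    then obtain k where k: "k \<in> KK" "i \<in> B k" by auto
    then have "(\<lambda>w. w k i) \<in> PiM KK ?D \<rightarrow>\<^sub>M M i"
      by (intro measurable_compose[OF measurable_component_singleton[of k KK ?D] measurable_component_singleton])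
    then show "(\<lambda>w. w (b i) i) \<in> PiM KK ?D \<rightarrow>\<^sub>M M i" by (simp only: b[OF k])
  qed
  have pD: "prob_space (?D k)" for k by (rule prob_space_PiM) (rule prob_space)
  interpret D: product_prob_space ?D KK by (intro product_prob_spaceI pD)
  show "distr (PiM KK ?D) (PiM ?J M) ?fl = PiM ?J M"
  proof (rule PiM_eqI)
    show "finite ?J" using KK by blast
    fix A assume A: "\<And>i. i \<in> ?J \<Longrightarrow> A i \<in> sets (M i)"
    have sub: "A i \<subseteq> space (M i)" if "i \<in> ?J" for i using A[OF that] sets.sets_into_space by blast
    have vim: "?fl -` Pi\<^sub>E ?J A \<inter> space (PiM KK ?D) = Pi\<^sub>E KK (\<lambda>k. Pi\<^sub>E (B k) A)"
    proof (intro set_eqI iffI)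
      fix w assume w: "w \<in> ?fl -` Pi\<^sub>E ?J A \<inter> space (PiM KK ?D)"
      then have wD: "w \<in> Pi\<^sub>E KK (\<lambda>k. Pi\<^sub>E (B k) (\<lambda>i. space (M i)))" and wA: "?fl w \<in> Pi\<^sub>E ?J A"
        by (simp_all add: space_PiM)
      show "w \<in> Pi\<^sub>E KK (\<lambda>k. Pi\<^sub>E (B k) A)"
      proof (rule PiE_I)
        fix k assume k: "k \<in> KK"
        show "w k \<in> Pi\<^sub>E (B k) A"
        proof (rule PiE_I)
          fix i assume i: "i \<in> B k"
          then have "?fl w i \<in> A i" using PiE_mem[OF wA, of i] k by blast
          then show "w k i \<in> A i" using k i b[OF k i] by (simp split: if_splits)
        next
          fix i assume "i \<notin> B k"
          then show "w k i = undefined" using PiE_mem[OF wD k] by (auto simp: PiE_iff extensional_def)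
        qed
      next
        fix k assume "k \<notin> KK" then show "w k = undefined" using wD by (auto simp: PiE_iff extensional_def)
      qed
    next
      fix w assume w: "w \<in> Pi\<^sub>E KK (\<lambda>k. Pi\<^sub>E (B k) A)"
      then have wk: "w k i \<in> A i" if "k \<in> KK" "i \<in> B k" for k i
        using that by (auto simp: PiE_iff)
      have "w (b i) i \<in> A i" if i: "i \<in> ?J" for i
      proof -
        from i obtain k where "k \<in> KK" "i \<in> B k" by blast
        then show ?thesis using wk b by simp
      qed
      moreover have "w \<in> space (PiM KK ?D)"
        unfolding space_PiM
      proof (rule PiE_I)
        fix k assume k: "k \<in> KK"
        then have "w k \<in> extensional (B k)" using w by (auto simp: PiE_iff)
        moreover have "w k i \<in> space (M i)" if "i \<in> B k" for i
          using wk[OF k that] sub[of i] k that by blast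
        ultimately show "w k \<in> Pi\<^sub>E (B k) (\<lambda>i. space (M i))" by (simp add: PiE_iff)
      qed (use w in \<open>simp add: PiE_iff extensional_def\<close>)
      moreover have "?fl w \<in> Pi\<^sub>E ?J A"
        using calculation(1) by (intro restrict_PiE_iff[THEN iffD2] ballI)
      ultimately show "w \<in> ?fl -` Pi\<^sub>E ?J A \<inter> space (PiM KK ?D)" by blast
    qed
    have disj: "B k \<inter> B k' = {}" if "k \<in> KK" "k' \<in> KK" "k \<noteq> k'" for k k'
    proof (rule ccontr)
      assume "B k \<inter> B k' \<noteq> {}"
      then obtain i where "i \<in> B k" "i \<in> B k'" by blast
      then show False using b[OF that(1)] b[OF that(2)] that(3) by metis
    qed
    have "emeasure (distr (PiM KK ?D) (PiM ?J M) ?fl) (Pi\<^sub>E ?J A) = emeasure (PiM KK ?D) (Pi\<^sub>E KK (\<lambda>k. Pi\<^sub>E (B k) A))"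
      using KK A by (subst emeasure_distr) (rule meas, rule sets_PiM_I_finite, blast, blast, simp only: vim)
    also have "\<dots> = (\<Prod>k\<in>KK. emeasure (?D k) (Pi\<^sub>E (B k) A))"
      using KK A by (intro D.emeasure_PiM sets_PiM_I_finite) blast+
    also have "\<dots> = (\<Prod>k\<in>KK. \<Prod>i\<in>B k. emeasure (M i) (A i))"
      using KK A by (intro prod.cong refl emeasure_PiM) blast+
    also have "\<dots> = (\<Prod>i\<in>?J. emeasure (M i) (A i))"
      using KK disj by (intro prod.UNION_disjoint[symmetric]) blast+
    finally show "emeasure (distr (PiM KK ?D) (PiM ?J M) ?fl) (Pi\<^sub>E ?J A) = (\<Prod>i\<in>?J. emeasure (M i) (A i))" .
  qed (rule sets_distr)
qed

text \<open>\<open>u\<close> bounds the sign-averaged complexity of the observations. Contraction by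
  \<open>\<psi>\<close> and symmetrization turn it into majorants of the signed block sums for every
  pattern on blocks, which is exactly the input that contraction by the truncated square and a
  second symmetrization need. The term with \<open>v\<close> bounds the expectations that the
  centring subtracts, and \<open>x\<close> is the concentration error.\<close>

lemma (in product_prob_space) blocks_deviation:
  fixes d q :: "'f \<Rightarrow> 'a \<Rightarrow> real" and \<psi> :: "'a \<Rightarrow> real \<Rightarrow> real" and B :: "'k \<Rightarrow> 'i set"
  assumes KK: "finite KK" "KK \<noteq> {}" "\<And>k. k \<in> KK \<Longrightarrow> finite (B k)"
    and disj: "\<And>k k'. k \<in> KK \<Longrightarrow> k' \<in> KK \<Longrightarrow> k \<noteq> k' \<Longrightarrow> B k \<inter> B k' = {}"
    and J: "J = (\<Union>k\<in>KK. B k)" and G: "G \<noteq> {}"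
    and U: "\<And>S. S \<subseteq> J \<Longrightarrow> integrable (PiM J M) (U S)"
    and maj: "AE z in PiM J M. \<forall>f\<in>G. \<forall>S. S \<subseteq> J \<longrightarrow> (\<Sum>i\<in>J. sg S i * d f (z i)) \<le> U S z"
    and U_sum: "(\<Sum>S\<in>Pow J. \<integral>z. U S z \<partial>PiM J M) \<le> 2 ^ card J * u"
    and L: "L > 0" and c: "c > 0" and x: "x > 0"
    and lip: "\<And>i y s t. y \<in> space (M i) \<Longrightarrow> \<bar>\<psi> y s - \<psi> y t\<bar> \<le> L * \<bar>s - t\<bar>"
    and zero: "\<And>i y. y \<in> space (M i) \<Longrightarrow> \<psi> y 0 = 0"
    and \<psi>_meas: "\<And>i. (\<lambda>p. \<psi> (fst p) (snd p)) \<in> borel_measurable (M i \<Otimes>\<^sub>M borel)"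
    and \<psi>_q: "\<And>f i y. f \<in> G \<Longrightarrow> y \<in> space (M i) \<Longrightarrow> \<psi> y (d f y) = q f y"
    and q_meas: "\<And>f i. f \<in> G \<Longrightarrow> q f \<in> borel_measurable (M i)"
    and q2: "\<And>f i. f \<in> G \<Longrightarrow> i \<in> J \<Longrightarrow> integrable (M i) (\<lambda>y. (q f y)\<^sup>2)"
    and q2_le: "\<And>f i. f \<in> G \<Longrightarrow> i \<in> J \<Longrightarrow> (\<integral>y. (q f y)\<^sup>2 \<partial>M i) \<le> v"
  obtains E where "E \<in> sets (PiM KK (\<lambda>k. PiM (B k) M))"
    "measure (PiM KK (\<lambda>k. PiM (B k) M)) E \<ge> 1 - exp (- 2 * x\<^sup>2 / real (card KK))"
    "\<And>w f. w \<in> E \<Longrightarrow> f \<in> G \<Longrightarrow>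
      (\<Sum>k\<in>KK. min 1 ((c * (\<Sum>i\<in>B k. q f (w k i) - (\<integral>y. q f y \<partial>M i)))\<^sup>2))
        \<le> c\<^sup>2 * (real (card J) * v) + 8 * c * L * u + x"
proof -
  define D where "D k = PiM (B k) M" for k
  have pD: "prob_space (D k)" for k unfolding D_def by (rule prob_space_PiM) (rule prob_space)
  interpret D: product_prob_space D KK by (intro product_prob_spaceI pD)
  interpret PK: prob_space "PiM KK D" by (rule prob_space_PiM) (rule pD)
  have fin_J: "finite J" using KK J by auto
  define b where "b i = (THE k. k \<in> KK \<and> i \<in> B k)" for i
  have b: "b i = k" if "k \<in> KK" "i \<in> B k" for k i
    unfolding b_def using that disj by (intro the_equality) blast+
  define fl where "fl w = (\<lambda>i\<in>J. w (b i) i)" for w :: "'k \<Rightarrow> 'i \<Rightarrow> 'a"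
  have fl [measurable]: "fl \<in> PiM KK D \<rightarrow>\<^sub>M PiM J M"
    and distr_fl: "distr (PiM KK D) (PiM J M) fl = PiM J M"
    unfolding fl_def[abs_def] J D_def[abs_def]
    by (rule distr_flatten_blocks; fact KK b)+
  have fl_apply: "fl w i = w k i" if "k \<in> KK" "i \<in> B k" for w k i
    using that b[OF that] J by (auto simp: fl_def)
  have sum_J: "(\<Sum>i\<in>J. g i) = (\<Sum>k\<in>KK. \<Sum>i\<in>B k. g i)" for g :: "'i \<Rightarrow> real"
    unfolding J using KK disj by (intro sum.UNION_disjoint) auto

  have \<psi>_meas': "(\<lambda>z. \<psi> (z i) (t z)) \<in> borel_measurable (PiM J M)"
    if "i \<in> J" and [measurable]: "t \<in> borel_measurable (PiM J M)" for i t
  proof -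
    have "(\<lambda>z. (z i, t z)) \<in> PiM J M \<rightarrow>\<^sub>M M i \<Otimes>\<^sub>M borel" using that by measurable
    from measurable_compose[OF this \<psi>_meas] show ?thesis by simp
  qed
  have comp_space: "z i \<in> space (M i)" if "i \<in> J" "z \<in> space (PiM J M)" for i z
    using that by (auto simp: space_PiM PiE_iff)
  obtain W where W: "\<And>S. S \<subseteq> J \<Longrightarrow> integrable (PiM J M) (W S)"
    and W_maj: "AE z in PiM J M. \<forall>f\<in>G. \<forall>S. S \<subseteq> J \<longrightarrow> (\<Sum>i\<in>J. sg S i * \<psi> (z i) (d f (z i))) \<le> W S z"
    and W_sum: "(\<Sum>S\<in>Pow J. \<integral>z. W S z \<partial>PiM J M) = L * (\<Sum>S\<in>Pow J. \<integral>z. U S z \<partial>PiM J M)"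
  proof (rule contraction_majorants[OF fin_J L U maj, where \<psi>="\<lambda>i z. \<psi> (z i)"])
    show "\<bar>\<psi> (z i) s - \<psi> (z i) t\<bar> \<le> L * \<bar>s - t\<bar>" if "i \<in> J" "z \<in> space (PiM J M)" for i z s t
      using comp_space[OF that] by (rule lip)
    show "\<psi> (z i) 0 = 0" if "i \<in> J" "z \<in> space (PiM J M)" for i z
      using comp_space[OF that] by (rule zero)
  qed (use \<psi>_meas' in auto)
  have W_maj': "AE z in PiM J M. \<forall>f\<in>G. \<forall>S. S \<subseteq> J \<longrightarrow> (\<Sum>i\<in>J. sg S i * q f (z i)) \<le> W S z"
    using W_maj
  proof (rule AE_mp_space)
    fix z assume z: "z \<in> space (PiM J M)"
      and *: "\<forall>f\<in>G. \<forall>S. S \<subseteq> J \<longrightarrow> (\<Sum>i\<in>J. sg S i * \<psi> (z i) (d f (z i))) \<le> W S z"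
    have "(\<Sum>i\<in>J. sg S i * \<psi> (z i) (d f (z i))) = (\<Sum>i\<in>J. sg S i * q f (z i))" if "f \<in> G" for f S
      using \<psi>_q[OF that comp_space[OF _ z]] by (intro sum.cong) auto
    with * show "\<forall>f\<in>G. \<forall>S. S \<subseteq> J \<longrightarrow> (\<Sum>i\<in>J. sg S i * q f (z i)) \<le> W S z" by simp
  qed
  have q1: "integrable (M i) (q f)" if "f \<in> G" "i \<in> J" for f i
    using q_meas[OF that(1)] q2[OF that] by (rule M.square_integrable_imp_integrable)
  define m where "m f i = (\<integral>y. q f y \<partial>M i)" for f i
  \<comment> \<open>One majorant for each pattern \<open>\<tau>\<close>, all with the same bound on
    the integral: they form the family fed to the second contraction.\<close>
  have "\<exists>H. integrable (PiM J M) H \<and>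
      (AE z in PiM J M. \<forall>f\<in>G. (\<Sum>i\<in>J. sg \<tau> i * (q f (z i) - m f i)) \<le> H z) \<and>
      (\<integral>z. H z \<partial>PiM J M) \<le> 2 * L * u" for \<tau>
  proof -
    obtain H where H: "integrable (PiM J M) H"
      "AE z in PiM J M. \<forall>f\<in>G. (\<Sum>i\<in>J. sg \<tau> i * (q f (z i) - (\<integral>x. q f x \<partial>M i))) \<le> H z"
      "(\<integral>z. H z \<partial>PiM J M) \<le> 2 / 2 ^ card J * (\<Sum>S\<in>Pow J. \<integral>z. W S z \<partial>PiM J M)"
      by (rule symmetrization_majorant[of J W G "\<lambda>f i. q f" \<tau>]) (assumption | rule that fin_J W W_maj' q1)+
    note H(3)
    also have "2 / 2 ^ card J * (\<Sum>S\<in>Pow J. \<integral>z. W S z \<partial>PiM J M) \<le> 2 / 2 ^ card J * (L * (2 ^ card J * u))"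
      unfolding W_sum using U_sum L by (intro mult_left_mono) auto
    finally show ?thesis using H by (intro exI[of _ H]) (auto simp: m_def)
  qed
  then have "\<forall>\<tau>. \<exists>H. integrable (PiM J M) H \<and>
      (AE z in PiM J M. \<forall>f\<in>G. (\<Sum>i\<in>J. sg \<tau> i * (q f (z i) - m f i)) \<le> H z) \<and>
      (\<integral>z. H z \<partial>PiM J M) \<le> 2 * L * u" by (rule allI)
  from choice[OF this] obtain H where H: "\<And>\<tau>. integrable (PiM J M) (H \<tau>)"
    and H_maj: "\<And>\<tau>. AE z in PiM J M. \<forall>f\<in>G. (\<Sum>i\<in>J. sg \<tau> i * (q f (z i) - m f i)) \<le> H \<tau> z"
    and H_int: "\<And>\<tau>. (\<integral>z. H \<tau> z \<partial>PiM J M) \<le> 2 * L * u"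
    by (elim exE) (rule that, (elim allE conjE, assumption)+)

  define t where "t f w k = (\<Sum>i\<in>B k. q f (w k i) - m f i)" for f w k
  \<comment> \<open>A pattern of blocks becomes a pattern of observations by taking the union of its
    positive blocks; disjointness of the blocks makes the sign constant on each.\<close>
  define H' where "H' \<tau> w = H (\<Union>k\<in>\<tau>. B k) (fl w)" for \<tau> w
  have H'_int: "integrable (PiM KK D) (H' \<tau>)" "(\<integral>w. H' \<tau> w \<partial>PiM KK D) \<le> 2 * L * u" for \<tau>
  proof -
    have "integrable (distr (PiM KK D) (PiM J M) fl) (H (\<Union>k\<in>\<tau>. B k))" using H distr_fl by simp
    then show "integrable (PiM KK D) (H' \<tau>)"
      unfolding H'_def by (rule integrable_distr[rotated]) simp
    have "(\<integral>w. H' \<tau> w \<partial>PiM KK D) = (\<integral>z. H (\<Union>k\<in>\<tau>. B k) z \<partial>distr (PiM KK D) (PiM J M) fl)"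
      unfolding H'_def using H by (intro integral_distr[symmetric]) auto
    then show "(\<integral>w. H' \<tau> w \<partial>PiM KK D) \<le> 2 * L * u" using H_int distr_fl by simp
  qed
  have H'_maj: "AE w in PiM KK D. \<forall>f\<in>G. \<forall>\<tau>. \<tau> \<subseteq> KK \<longrightarrow> (\<Sum>k\<in>KK. sg \<tau> k * t f w k) \<le> H' \<tau> w"
  proof -
    have each: "AE w in PiM KK D. \<forall>f\<in>G. (\<Sum>k\<in>KK. sg \<tau> k * t f w k) \<le> H' \<tau> w" if \<tau>: "\<tau> \<in> Pow KK" for \<tau>
    proof -
      have "AE z in distr (PiM KK D) (PiM J M) fl. \<forall>f\<in>G. (\<Sum>i\<in>J. sg (\<Union>k\<in>\<tau>. B k) i * (q f (z i) - m f i)) \<le> H (\<Union>k\<in>\<tau>. B k) z"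
        unfolding distr_fl by (rule H_maj)
      from AE_distrD[OF fl this] show ?thesis
      proof (rule AE_mp_space)
        fix w assume *: "\<forall>f\<in>G. (\<Sum>i\<in>J. sg (\<Union>k\<in>\<tau>. B k) i * (q f (fl w i) - m f i)) \<le> H (\<Union>k\<in>\<tau>. B k) (fl w)"
        have "(\<Sum>i\<in>J. sg (\<Union>k\<in>\<tau>. B k) i * (q f (fl w i) - m f i)) = (\<Sum>k\<in>KK. sg \<tau> k * t f w k)" for f
        proof -
          have "sg (\<Union>k\<in>\<tau>. B k) i = sg \<tau> k" if "k \<in> KK" "i \<in> B k" for k i
            using that disj \<tau> by (auto simp: sg_def)
          then show ?thesis
            unfolding sum_J t_def sum_distrib_left by (intro sum.cong refl) (simp add: fl_apply)
        qed
        with * show "\<forall>f\<in>G. (\<Sum>k\<in>KK. sg \<tau> k * t f w k) \<le> H' \<tau> w" by (simp add: H'_def)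
      qed
    qed
    have "AE w in PiM KK D. \<forall>\<tau>\<in>Pow KK. \<forall>f\<in>G. (\<Sum>k\<in>KK. sg \<tau> k * t f w k) \<le> H' \<tau> w"
      by (rule AE_finite_allI[OF _ each]) (simp_all add: KK(1))
    then show ?thesis by eventually_elim auto
  qed
  define \<phi> where "\<phi> f k y = min 1 ((c * (\<Sum>i\<in>B k. q f (y i) - m f i))\<^sup>2)" for f k y
  have \<phi>_range: "0 \<le> \<phi> f k y" "\<phi> f k y \<le> 1" for f k y by (auto simp: \<phi>_def)
  obtain V where V: "\<And>S. S \<subseteq> KK \<Longrightarrow> integrable (PiM KK D) (V S)"
    and V_maj: "AE w in PiM KK D. \<forall>f\<in>G. \<forall>S. S \<subseteq> KK \<longrightarrow> (\<Sum>k\<in>KK. sg S k * min 1 ((c * t f w k)\<^sup>2)) \<le> V S w"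
    and V_sum: "(\<Sum>S\<in>Pow KK. \<integral>w. V S w \<partial>PiM KK D) = (2 * c) * (\<Sum>S\<in>Pow KK. \<integral>w. H' S w \<partial>PiM KK D)"
  proof (rule contraction_majorants[OF KK(1) _ H'_int(1) H'_maj, where \<psi>="\<lambda>k w r. min 1 ((c * r)\<^sup>2)" and \<Lambda>="2 * c"])
    show "\<bar>min 1 ((c * r)\<^sup>2) - min 1 ((c * s)\<^sup>2)\<bar> \<le> 2 * c * \<bar>r - s\<bar>" for r s
      using min_square_lipschitz[of "c * r" "c * s"] c
      by (simp add: right_diff_distrib[symmetric] abs_mult)
  qed (use c in auto)
  have \<phi>_meas [measurable]: "\<phi> f k \<in> borel_measurable (D k)" if f: "f \<in> G" and "k \<in> KK" for f k
  proof -
    have [measurable]: "(\<lambda>y. q f (y i)) \<in> borel_measurable (PiM (B k) M)" if "i \<in> B k" for i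
      using measurable_compose[OF measurable_component_singleton[OF that] q_meas[OF f]] .
    show ?thesis unfolding \<phi>_def D_def by measurable
  qed
  have \<phi>_int: "integrable (D k) (\<phi> f k)" if "f \<in> G" "k \<in> KK" for f k
    using \<phi>_meas[OF that] \<phi>_range by (intro D.M.integrable_const_bound[where B=1]) auto
  define \<epsilon> where "\<epsilon> f k = (\<integral>y. \<phi> f k y \<partial>D k)" for f k
  have \<epsilon>_range: "0 \<le> \<epsilon> f k" "\<epsilon> f k \<le> 1" if "f \<in> G" "k \<in> KK" for f k
  proof -
    show "0 \<le> \<epsilon> f k" unfolding \<epsilon>_def using \<phi>_range by (intro Bochner_Integration.integral_nonneg) auto
    have "\<epsilon> f k \<le> (\<integral>y. 1 \<partial>D k)"
      unfolding \<epsilon>_def using \<phi>_range \<phi>_int[OF that] by (intro integral_mono) auto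
    then show "\<epsilon> f k \<le> 1" by (simp add: D.M.prob_space)
  qed
  \<comment> \<open>Chebyshev at the level of expectations: the truncation is dropped and the cross
    terms of the centred block sum vanish.\<close>
  have \<epsilon>_sum: "(\<Sum>k\<in>KK. \<epsilon> f k) \<le> c\<^sup>2 * (real (card J) * v)" if f: "f \<in> G" for f
  proof -
    have "\<epsilon> f k \<le> c\<^sup>2 * (\<Sum>i\<in>B k. v)" if k: "k \<in> KK" for k
    proof -
      have BJ: "B k \<subseteq> J" using k J by auto
      have ctr: "integrable (M i) (\<lambda>y. (q f y - m f i)\<^sup>2)" "(\<integral>y. (q f y - m f i)\<^sup>2 \<partial>M i) \<le> v"
        "(\<integral>y. q f y - m f i \<partial>M i) = 0" if "i \<in> J" for i
      proof -
        note int = q1[OF f that] q2[OF f that]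
        show "integrable (M i) (\<lambda>y. (q f y - m f i)\<^sup>2)"
          unfolding power2_diff using int by auto
        have "(\<integral>y. (q f y - m f i)\<^sup>2 \<partial>M i) = (\<integral>y. (q f y)\<^sup>2 \<partial>M i) - (m f i)\<^sup>2"
          unfolding m_def using int by (intro M.variance_eq)
        then show "(\<integral>y. (q f y - m f i)\<^sup>2 \<partial>M i) \<le> v"
          using q2_le[OF f that] zero_le_power2[of "m f i"] by linarith
        show "(\<integral>y. q f y - m f i \<partial>M i) = 0"
          using int by (simp add: m_def M.prob_space)
      qed
      have s: "integrable (D k) (\<lambda>y. (\<Sum>i\<in>B k. q f (y i) - m f i)\<^sup>2)"
        "(\<integral>y. (\<Sum>i\<in>B k. q f (y i) - m f i)\<^sup>2 \<partial>D k) = (\<Sum>i\<in>B k. \<integral>x. (q f x - m f i)\<^sup>2 \<partial>M i)"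
        using PiM_second_moment_sum[OF KK(3)[OF k], of "\<lambda>i x. q f x - m f i"] ctr BJ q_meas[OF f]
        unfolding D_def by (auto simp: subset_eq)
      have "\<epsilon> f k \<le> (\<integral>y. c\<^sup>2 * (\<Sum>i\<in>B k. q f (y i) - m f i)\<^sup>2 \<partial>D k)"
        unfolding \<epsilon>_def using \<phi>_int[OF f k] s(1)
        by (intro integral_mono) (auto simp: \<phi>_def power_mult_distrib)
      also have "\<dots> = c\<^sup>2 * (\<Sum>i\<in>B k. \<integral>x. (q f x - m f i)\<^sup>2 \<partial>M i)" using s by simp
      also have "\<dots> \<le> c\<^sup>2 * (\<Sum>i\<in>B k. v)"
        using ctr BJ by (intro mult_left_mono sum_mono) auto
      finally show ?thesis .
    qed
    then have "(\<Sum>k\<in>KK. \<epsilon> f k) \<le> (\<Sum>k\<in>KK. c\<^sup>2 * (\<Sum>i\<in>B k. v))" by (rule sum_mono)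
    also have "\<dots> = c\<^sup>2 * (\<Sum>i\<in>J. v)" unfolding sum_J by (simp only: sum_distrib_left)
    finally show ?thesis by simp
  qed
  have t_\<phi>: "min 1 ((c * t f w k)\<^sup>2) = \<phi> f k (w k)" for f w k by (simp add: t_def \<phi>_def)
  \<comment> \<open>The pattern \<open>KK\<close> carries the sign +1 on every block, so
    \<open>R\<close> majorizes the plain, unsigned deviation.\<close>
  obtain R where R: "integrable (PiM KK D) R"
    "AE w in PiM KK D. \<forall>f\<in>G. (\<Sum>k\<in>KK. sg KK k * (\<phi> f k (w k) - \<epsilon> f k)) \<le> R w"
    "(\<integral>w. R w \<partial>PiM KK D) \<le> 2 / 2 ^ card KK * (\<Sum>S\<in>Pow KK. \<integral>w. V S w \<partial>PiM KK D)"
    unfolding \<epsilon>_def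
    by (rule D.symmetrization_majorant[of KK V G \<phi> KK]) (assumption | rule that KK(1) V V_maj[unfolded t_\<phi>] \<phi>_int)+
  have R_int: "(\<integral>w. R w \<partial>PiM KK D) \<le> 8 * c * L * u"
  proof -
    have "(\<Sum>S\<in>Pow KK. \<integral>w. H' S w \<partial>PiM KK D) \<le> (\<Sum>S\<in>Pow KK. 2 * L * u)"
      by (intro sum_mono H'_int)
    also have "\<dots> = 2 ^ card KK * (2 * L * u)" using KK by (simp add: card_Pow)
    finally have "2 / 2 ^ card KK * (2 * c * (\<Sum>S\<in>Pow KK. \<integral>w. H' S w \<partial>PiM KK D))
        \<le> 2 / 2 ^ card KK * (2 * c * (2 ^ card KK * (2 * L * u)))"
      using c by (intro mult_left_mono) auto
    also have "\<dots> = 8 * c * L * u" by simp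
    finally show ?thesis using R(3) unfolding V_sum by simp
  qed
  \<comment> \<open>Possibly non-measurable. As \<open>\<phi>\<close> takes values in [0,1],
    changing one block moves the supremum by at most 1.\<close>
  define g where "g w = (SUP f\<in>G. \<Sum>k\<in>KK. \<phi> f k (w k) - \<epsilon> f k)" for w
  have dev_le: "(\<Sum>k\<in>KK. \<phi> f k (w k) - \<epsilon> f k) \<le> real (card KK)"
    and dev_ge: "- real (card KK) \<le> (\<Sum>k\<in>KK. \<phi> f k (w k) - \<epsilon> f k)" if "f \<in> G" for f w
  proof -
    have "(\<Sum>k\<in>KK. \<phi> f k (w k) - \<epsilon> f k) \<le> (\<Sum>k\<in>KK. 1)"
      by (intro sum_mono) (smt (verit) \<phi>_range \<epsilon>_range that)
    then show "(\<Sum>k\<in>KK. \<phi> f k (w k) - \<epsilon> f k) \<le> real (card KK)" by simp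
    have "(\<Sum>k\<in>KK. - 1) \<le> (\<Sum>k\<in>KK. \<phi> f k (w k) - \<epsilon> f k)"
      by (intro sum_mono) (smt (verit) \<phi>_range \<epsilon>_range that)
    then show "- real (card KK) \<le> (\<Sum>k\<in>KK. \<phi> f k (w k) - \<epsilon> f k)" by (simp add: sum_negf)
  qed
  have bdd: "bdd_above ((\<lambda>f. \<Sum>k\<in>KK. \<phi> f k (w k) - \<epsilon> f k) ` G)" for w
    using dev_le by (intro bdd_aboveI2) auto
  have g_ge: "(\<Sum>k\<in>KK. \<phi> f k (w k) - \<epsilon> f k) \<le> g w" if "f \<in> G" for f w
    unfolding g_def using that bdd by (rule cSUP_upper)
  obtain E where E: "E \<in> sets (PiM KK D)"
    "measure (PiM KK D) E \<ge> 1 - exp (- 2 * x\<^sup>2 / (real (card KK) * 1\<^sup>2))"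
    "\<And>w. w \<in> E \<Longrightarrow> g w \<le> (\<integral>w. R w \<partial>PiM KK D) + x"
  proof (rule D.McDiarmid_outer[OF KK(1,2), of g "real (card KK)" 1 x R])
    fix w
    obtain f where "f \<in> G" using G by auto
    have "g w \<le> real (card KK)" unfolding g_def using G dev_le by (rule cSUP_least)
    moreover have "- real (card KK) \<le> g w" using dev_ge g_ge \<open>f \<in> G\<close> order_trans by blast
    ultimately show "\<bar>g w\<bar> \<le> real (card KK)" by simp
    fix k y assume k: "k \<in> KK"
    show "g w \<le> g (w(k := y)) + 1"
      unfolding g_def[of w]
    proof (rule cSUP_least[OF G])
      fix f assume f: "f \<in> G"
      have "(\<Sum>j\<in>KK. \<phi> f j (w j) - \<epsilon> f j) = (\<phi> f k (w k) - \<epsilon> f k) + (\<Sum>j\<in>KK - {k}. \<phi> f j (w j) - \<epsilon> f j)"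
        using KK(1) k by (rule sum.remove)
      also have "\<dots> \<le> (\<phi> f k y - \<epsilon> f k + 1) + (\<Sum>j\<in>KK - {k}. \<phi> f j ((w(k := y)) j) - \<epsilon> f j)"
        using \<phi>_range[of f k] by (intro add_mono sum_mono) (auto simp: add_increasing)
      also have "\<dots> = (\<Sum>j\<in>KK. \<phi> f j ((w(k := y)) j) - \<epsilon> f j) + 1"
        using sum.remove[OF KK(1) k, of "\<lambda>j. \<phi> f j ((w(k := y)) j) - \<epsilon> f j"] by simp
      also have "\<dots> \<le> g (w(k := y)) + 1" by (rule add_right_mono[OF g_ge[OF f]])
      finally show "(\<Sum>j\<in>KK. \<phi> f j (w j) - \<epsilon> f j) \<le> g (w(k := y)) + 1" .
    qed
  next
    show "AE w in PiM KK D. g w \<le> R w"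
      using R(2)
    proof eventually_elim
      case (elim w)
      show "g w \<le> R w"
        unfolding g_def using elim by (intro cSUP_least[OF G]) (auto simp: sg_def)
    qed
  qed (use x R in auto)
  show thesis
  proof (rule that[of E])
    show "E \<in> sets (PiM KK (\<lambda>k. PiM (B k) M))" using E(1) unfolding D_def[abs_def] .
    show "measure (PiM KK (\<lambda>k. PiM (B k) M)) E \<ge> 1 - exp (- 2 * x\<^sup>2 / real (card KK))"
      using E(2) unfolding D_def[abs_def] by simp
    fix w f assume w: "w \<in> E" and f: "f \<in> G"
    have "(\<Sum>k\<in>KK. \<phi> f k (w k)) = (\<Sum>k\<in>KK. \<phi> f k (w k) - \<epsilon> f k) + (\<Sum>k\<in>KK. \<epsilon> f k)"
      by (simp add: sum_subtractf)
    also have "\<dots> \<le> (8 * c * L * u + x) + c\<^sup>2 * (real (card J) * v)"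
      using g_ge[OF f, of w] E(3)[OF w] R_int \<epsilon>_sum[OF f] by linarith
    finally show "(\<Sum>k\<in>KK. min 1 ((c * (\<Sum>i\<in>B k. q f (w k i) - (\<integral>y. q f y \<partial>M i)))\<^sup>2))
        \<le> c\<^sup>2 * (real (card J) * v) + 8 * c * L * u + x"
      by (simp add: \<phi>_def m_def)
  qed
qed

subsection \<open>Medians and the minmax estimator\<close>

text \<open>Pigeonhole: a strict majority of the indices meets every set containing at least half of
  them. Only the defining property is used, so any choice of median is covered.\<close>

lemma median_ge:
  assumes med: "is_median K v m" and maj: "K < 2 * card T" and T: "T \<subseteq> {1..K}" "\<And>k. k \<in> T \<Longrightarrow> c \<le> v k"
  shows "c \<le> m"
proof (rule ccontr)
  assume "\<not> c \<le> m"
  then have "T \<inter> {k \<in> {1..K}. v k \<le> m} = {}" using T by fastforce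
  then have "card T + card {k \<in> {1..K}. v k \<le> m} = card (T \<union> {k \<in> {1..K}. v k \<le> m})"
    using T finite_subset[OF T(1)] by (intro card_Un_disjoint[symmetric]) auto
  also have "\<dots> \<le> card {1..K}" using T by (intro card_mono) auto
  finally show False using med maj unfolding is_median_def by auto
qed

lemma median_le:
  assumes med: "is_median K v m" and maj: "K < 2 * card T" and T: "T \<subseteq> {1..K}" "\<And>k. k \<in> T \<Longrightarrow> v k \<le> c"
  shows "m \<le> c"
proof (rule ccontr)
  assume "\<not> m \<le> c"
  then have "T \<inter> {k \<in> {1..K}. v k \<ge> m} = {}" using T by fastforce
  then have "card T + card {k \<in> {1..K}. v k \<ge> m} = card (T \<union> {k \<in> {1..K}. v k \<ge> m})"
    using T finite_subset[OF T(1)] by (intro card_Un_disjoint[symmetric]) auto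
  also have "\<dots> \<le> card {1..K}" using T by (intro card_mono) auto
  finally show False using med maj unfolding is_median_def by auto
qed

lemma L2norm_scale: "L2norm \<mu> (\<lambda>x. t * g x) = \<bar>t\<bar> * L2norm \<mu> g"
  by (simp add: L2norm_def power_mult_distrib real_sqrt_mult)

lemma block_mean_mono:
  assumes "\<And>i. i \<in> Bk \<Longrightarrow> h i \<le> h' i"
  shows "block_mean N K Bk h \<le> block_mean N K Bk h'"
  unfolding block_mean_def using assms by (intro mult_left_mono sum_mono) auto

lemma block_mean_scale: "block_mean N K Bk (\<lambda>i. t * h i) = t * block_mean N K Bk h"
  by (simp add: block_mean_def sum_distrib_left mult.left_commute)

lemma block_mean_minus: "block_mean N K Bk (\<lambda>i. - h i) = - block_mean N K Bk h"
  by (simp add: block_mean_def sum_negf)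

text \<open>Off the ball, convexity propagates the lower bound from the sphere, magnified by the
  ratio of the radii.\<close>
lemma minmax_MOM_error_bound:
  fixes F :: "('x \<Rightarrow> real) set" and z :: "nat \<Rightarrow> 'x \<times> 'y"
  assumes med: "\<And>v. is_median K v (med v)"
    and KK: "KK \<subseteq> {1..K}"
    and z: "\<And>k i. k \<in> KK \<Longrightarrow> i \<in> B k \<Longrightarrow> fst (z i) \<in> S \<and> snd (z i) \<in> Y"
    and vals: "\<And>f x. f \<in> F \<Longrightarrow> x \<in> S \<Longrightarrow> f x \<in> Ybar"
    and conv: "\<And>y. y \<in> Y \<Longrightarrow> convex_on Ybar (\<lambda>u. lbar u y)"
    and F_conv: "\<And>f t. f \<in> F \<Longrightarrow> 0 \<le> t \<Longrightarrow> t \<le> 1 \<Longrightarrow> (\<lambda>x. (1 - t) * fs x + t * f x) \<in> F"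
    and fs: "fs \<in> F" and A: "A > 0" and r: "r > 0"
    and R_nonneg: "\<And>f. f \<in> F \<Longrightarrow> 0 \<le> R f"
    and bern: "\<And>f. f \<in> F \<Longrightarrow> L2norm \<mu> (\<lambda>x. f x - fs x) = r \<Longrightarrow> r\<^sup>2 \<le> A * R f"
    and good: "\<And>f. f \<in> F \<Longrightarrow> L2norm \<mu> (\<lambda>x. f x - fs x) \<le> r \<Longrightarrow>
      K < 2 * card {k \<in> KK. \<bar>block_mean N K (B k) (\<lambda>i. lbar (f (fst (z i))) (snd (z i)) - lbar (fs (fst (z i))) (snd (z i))) - R f\<bar> \<le> r\<^sup>2 / (3 * A)}"
    and fh: "is_minmax_MOM med N K B lbar F z fh"
  shows "L2norm \<mu> (\<lambda>x. fh x - fs x) \<le> r \<and> R fh \<le> 2 / (3 * A) * r\<^sup>2"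
proof -
  \<comment> \<open>On the sphere the Bernstein condition gives \<open>R f0\<close> at least
    \<open>3 * \<delta>\<close>, so a good block still shows \<open>2 * \<delta>\<close>, strictly
    more than the bound \<open>\<delta>\<close> on the criterion at \<open>fs\<close>.\<close>
  define \<delta> where "\<delta> = r\<^sup>2 / (3 * A)"
  have \<delta>: "\<delta> > 0" using r A by (simp add: \<delta>_def)
  define l where "l f i = lbar (f (fst (z i))) (snd (z i))" for f i
  define \<E> where "\<E> f k = block_mean N K (B k) (\<lambda>i. l f i - l fs i)" for f k
  define nrm where "nrm f = L2norm \<mu> (\<lambda>x. f x - fs x)" for f
  define Gd where "Gd f = {k \<in> KK. \<bar>\<E> f k - R f\<bar> \<le> \<delta>}" for f
  have Gd: "K < 2 * card (Gd f)" if "f \<in> F" "nrm f \<le> r" for f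
    using good[OF that(1)] that(2) by (simp add: Gd_def \<E>_def l_def nrm_def \<delta>_def)
  have Gd_sub: "Gd f \<subseteq> {1..K}" for f using KK by (auto simp: Gd_def)
  have outside: "\<exists>T\<subseteq>{1..K}. K < 2 * card T \<and> (\<forall>k\<in>T. 2 * \<delta> \<le> \<E> f k)" if f: "f \<in> F" and out: "nrm f > r" for f
  proof -
    \<comment> \<open>\<open>f0\<close> is the point where the segment from \<open>fs\<close> to
      \<open>f\<close> crosses the sphere; the Bernstein condition is available only there.\<close>
    define t where "t = r / nrm f"
    have t: "0 < t" "t < 1" using r out by (auto simp: t_def)
    define f0 where "f0 = (\<lambda>x. (1 - t) * fs x + t * f x)"
    have f0: "f0 \<in> F" unfolding f0_def using F_conv f t by simp
    have "(\<lambda>x. f0 x - fs x) = (\<lambda>x. t * (f x - fs x))" by (simp add: f0_def fun_eq_iff algebra_simps)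
    then have nrm0: "nrm f0 = r"
      using t r out unfolding nrm_def by (simp add: L2norm_scale) (simp add: t_def nrm_def)
    have R0: "3 * \<delta> \<le> R f0"
      using bern[OF f0] nrm0 A by (simp add: nrm_def \<delta>_def field_simps)
    have "2 * \<delta> \<le> \<E> f k" if k: "k \<in> Gd f0" for k
    proof -
      have "\<E> f0 k \<le> block_mean N K (B k) (\<lambda>i. t * (l f i - l fs i))"
        unfolding \<E>_def
      proof (rule block_mean_mono)
        fix i assume i: "i \<in> B k"
        from k i z have zi: "fst (z i) \<in> S" "snd (z i) \<in> Y" by (auto simp: Gd_def)
        have "l f0 i \<le> (1 - t) * l fs i + t * l f i"
          unfolding l_def f0_def using conv[OF zi(2)] vals[OF f zi(1)] vals[OF fs zi(1)] t
          by (auto simp: convex_on_def)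
        then show "l f0 i - l fs i \<le> t * (l f i - l fs i)" by (simp add: algebra_simps)
      qed
      then have "\<E> f0 k \<le> t * \<E> f k" by (simp add: block_mean_scale \<E>_def)
      moreover have "2 * \<delta> \<le> \<E> f0 k" using k R0 by (auto simp: Gd_def abs_le_iff)
      ultimately have *: "2 * \<delta> \<le> t * \<E> f k" by simp
      \<comment> \<open>Positivity is what permits dropping the factor \<open>t < 1\<close>.\<close>
      then have "0 < \<E> f k" using \<delta> t by (smt (verit) mult_nonneg_nonpos)
      then have "t * \<E> f k \<le> \<E> f k" using t by (simp add: mult_left_le_one_le)
      with * show ?thesis by simp
    qed
    then show ?thesis using Gd[OF f0] nrm0 Gd_sub by (intro exI[of _ "Gd f0"]) auto
  qed
  have crit_fs: "minmax_MOM_crit med N K B lbar F z fs \<le> ereal \<delta>"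
    unfolding minmax_MOM_crit_def
  proof (rule SUP_least)
    fix g assume g: "g \<in> F"
    have neg: "block_mean N K (B k) (\<lambda>i. l fs i - l g i) = - \<E> g k" for k
      by (simp add: \<E>_def block_mean_minus[symmetric])
    have "\<exists>T\<subseteq>{1..K}. K < 2 * card T \<and> (\<forall>k\<in>T. - \<E> g k \<le> \<delta>)"
    proof (cases "nrm g \<le> r")
      case True
      have "- \<E> g k \<le> \<delta>" if "k \<in> Gd g" for k
        using that R_nonneg[OF g] by (auto simp: Gd_def abs_le_iff)
      then show ?thesis using Gd[OF g True] Gd_sub by blast
    next
      case False
      then obtain T where "T \<subseteq> {1..K}" "K < 2 * card T" "\<forall>k\<in>T. 2 * \<delta> \<le> \<E> g k"
        using outside[OF g] by auto
      then show ?thesis using \<delta> by (intro exI[of _ T]) fastforce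
    qed
    then obtain T where "T \<subseteq> {1..K}" "K < 2 * card T" "\<forall>k\<in>T. - \<E> g k \<le> \<delta>" by blast
    then have "MOM med N K B (\<lambda>i. l fs i - l g i) \<le> \<delta>"
      unfolding MOM_def by (intro median_le[OF med, of T]) (auto simp: neg)
    then show "ereal (MOM med N K B (\<lambda>i. lbar (fs (fst (z i))) (snd (z i)) - lbar (g (fst (z i))) (snd (z i)))) \<le> ereal \<delta>"
      by (simp add: l_def)
  qed
  have fhF: "fh \<in> F" using fh by (simp add: is_minmax_MOM_def)
  \<comment> \<open>The choice \<open>g = fs\<close> in the supremum, followed by minimality of
    \<open>fh\<close> against the competitor \<open>fs\<close>.\<close>
  have "ereal (MOM med N K B (\<lambda>i. l fh i - l fs i)) \<le> minmax_MOM_crit med N K B lbar F z fh"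
    unfolding minmax_MOM_crit_def l_def using fs by (intro SUP_upper2[of fs]) auto
  also have "\<dots> \<le> minmax_MOM_crit med N K B lbar F z fs"
    using fh fs by (simp add: is_minmax_MOM_def)
  also note crit_fs
  finally have le: "MOM med N K B (\<lambda>i. l fh i - l fs i) \<le> \<delta>" by simp
  have inside: "nrm fh \<le> r"
  proof (rule ccontr)
    assume "\<not> nrm fh \<le> r"
    then obtain T where "T \<subseteq> {1..K}" "K < 2 * card T" "\<forall>k\<in>T. 2 * \<delta> \<le> \<E> fh k"
      using outside[OF fhF] by auto
    then have "2 * \<delta> \<le> MOM med N K B (\<lambda>i. l fh i - l fs i)"
      unfolding MOM_def by (intro median_ge[OF med, of T]) (auto simp: \<E>_def)
    then show False using le \<delta> by simp
  qed
  have "R fh - \<delta> \<le> MOM med N K B (\<lambda>i. l fh i - l fs i)"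
    unfolding MOM_def
    by (rule median_ge[OF med Gd[OF fhF inside] Gd_sub]) (auto simp: Gd_def \<E>_def abs_le_iff)
  then have "R fh \<le> 2 * \<delta>" using le by simp
  then show ?thesis using inside by (simp add: nrm_def \<delta>_def)
qed

text \<open>Choosing one outlier in every contaminated block is injective, as the blocks are
  disjoint.\<close>

lemma card_hit_blocks_le:
  assumes "finite Out" and disj: "\<And>k k'. k \<in> KA \<Longrightarrow> k' \<in> KA \<Longrightarrow> k \<noteq> k' \<Longrightarrow> B k \<inter> B k' = {}"
  shows "card {k \<in> KA. B k \<inter> Out \<noteq> {}} \<le> card Out"
proof -
  define c where "c k = (SOME i. i \<in> B k \<inter> Out)" for k
  have c: "c k \<in> B k \<inter> Out" if "B k \<inter> Out \<noteq> {}" for k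
    unfolding c_def using that by (subst some_in_eq)
  show ?thesis
  proof (rule card_inj_on_le[of c])
    show "inj_on c {k \<in> KA. B k \<inter> Out \<noteq> {}}"
    proof (rule inj_onI, rule ccontr)
      fix k k' assume k: "k \<in> {k \<in> KA. B k \<inter> Out \<noteq> {}}" "k' \<in> {k \<in> KA. B k \<inter> Out \<noteq> {}}" "c k = c k'" "k \<noteq> k'"
      then have "c k \<in> B k" "c k' \<in> B k'" using c by blast+
      moreover have "B k \<inter> B k' = {}" using k disj by blast
      ultimately show False using k(3) by (metis disjoint_iff)
    qed
    show "c ` {k \<in> KA. B k \<inter> Out \<noteq> {}} \<subseteq> Out" using c by blast
  qed fact
qed

text \<open>One event serves all minimizers \<open>fh\<close> at once, so no measurable selection of
  an estimator is involved. The hypothesis \<open>r2_nonempty\<close> keeps the infimum meaningful,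
  since the real \<open>Inf\<close> of the empty set carries no information.\<close>

theorem theorem2:
  fixes M :: "'w measure"
    and MX :: "'x measure" and MY :: "'y measure"
    and P :: "('x \<times> 'y) measure"
    and Ybar :: "real set"
    and F :: "('x \<Rightarrow> real) set" and fs :: "'x \<Rightarrow> real"
    and lbar :: "real \<Rightarrow> 'y \<Rightarrow> real"
    and L A r2 :: real
    and N K :: nat
    and Z :: "nat \<Rightarrow> 'w \<Rightarrow> 'x \<times> 'y"
    and Out :: "nat set"
    and B :: "nat \<Rightarrow> nat set"
    and med :: "(nat \<Rightarrow> real) \<Rightarrow> real"
  assumes M: "prob_space M"
    and P: "prob_space P" "sets P = sets (MX \<Otimes>\<^sub>M MY)"
    \<comment> \<open>the class F\<close>
    and Ybar: "convex Ybar"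
    and F_meas: "\<forall>f\<in>F. f \<in> borel_measurable MX"
    and F_L2: "\<forall>f\<in>F. integrable (distr P MX fst) (\<lambda>x. (f x)\<^sup>2)"
    and F_vals: "\<forall>f\<in>F. \<forall>x\<in>space MX. f x \<in> Ybar"
    and loss_meas: "\<forall>f\<in>F. (\<lambda>z. lbar (f (fst z)) (snd z)) \<in> borel_measurable (MX \<Otimes>\<^sub>M MY)"
    \<comment> \<open>(Lip-Conv)\<close>
    and L_pos: "L > 0"
    and Lip_Conv: "\<forall>y\<in>space MY. convex_on Ybar (\<lambda>u. lbar u y) \<and>
                     (\<forall>u\<in>Ybar. \<forall>v\<in>Ybar. \<bar>lbar u y - lbar v y\<bar> \<le> L * \<bar>u - v\<bar>)"
    \<comment> \<open>(Conv)\<close>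
    and Conv: "\<forall>f\<in>F. \<forall>g\<in>F. \<forall>t\<in>{0..1::real}. (\<lambda>x. (1 - t) * f x + t * g x) \<in> F"
    \<comment> \<open>fs is the unique risk minimizer over F\<close>
    and fs_in: "fs \<in> F"
    and fs_min: "\<forall>f\<in>F. excess_risk P lbar f fs \<ge> 0"
    and fs_unique: "\<forall>f\<in>F. excess_risk P lbar f fs = 0 \<longrightarrow> f = fs"
    \<comment> \<open>outliers / inliers and (Inl)\<close>
    and O_sub: "Out \<subseteq> {1..N}"
    and Inl_indep: "prob_space.indep_vars M (\<lambda>_. MX \<Otimes>\<^sub>M MY) Z ({1..N} - Out)"
    and Inl_L2: "\<forall>i\<in>{1..N} - Out. \<forall>f\<in>F.
        (\<integral>\<^sup>+x. ennreal ((f x - fs x)\<^sup>2) \<partial>(distr M MX (\<lambda>\<omega>. fst (Z i \<omega>))))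
          = (\<integral>\<^sup>+x. ennreal ((f x - fs x)\<^sup>2) \<partial>(distr P MX fst))"
    and Inl_risk: "\<forall>i\<in>{1..N} - Out. \<forall>f\<in>F.
        excess_risk (distr M (MX \<Otimes>\<^sub>M MY) (Z i)) lbar f fs = excess_risk P lbar f fs"
    \<comment> \<open>complexity parameter r2 = r~_2(1/(575 A L))\<close>
    and r2_pos: "r2 > 0"
    and r2_nonempty: "{r. r > 0 \<and> rad_condition (distr P MX fst) (\<lambda>i. distr M MX (\<lambda>\<omega>. fst (Z i \<omega>)))
                           F fs ({1..N} - Out) N (1 / (575 * A * L)) r} \<noteq> {}"
    and r2_ge: "r2 \<ge> Inf {r. r > 0 \<and> rad_condition (distr P MX fst) (\<lambda>i. distr M MX (\<lambda>\<omega>. fst (Z i \<omega>)))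
                           F fs ({1..N} - Out) N (1 / (575 * A * L)) r}"
    \<comment> \<open>(Bern-MOM)\<close>
    and A_pos: "A > 0"
    and Bern_MOM: "\<forall>f\<in>F. (L2norm (distr P MX fst) (\<lambda>x. f x - fs x))\<^sup>2
                             = max (r2\<^sup>2) (864 * A\<^sup>2 * L\<^sup>2 * real K / real N) \<longrightarrow>
                   (L2norm (distr P MX fst) (\<lambda>x. f x - fs x))\<^sup>2 \<le> A * excess_risk P lbar f fs"
    \<comment> \<open>number of outliers and blocks\<close>
    and O_card: "7 * card Out \<le> 3 * N"
    and K_pos: "0 < K"
    and K_lower: "7 * card Out \<le> 3 * K"
    and K_upper: "K \<le> N"
    and K_dvd: "K dvd N"
    and B_sub: "\<forall>k\<in>{1..K}. B k \<subseteq> {1..N} \<and> card (B k) = N div K"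
    and B_disj: "\<forall>k\<in>{1..K}. \<forall>k'\<in>{1..K}. k \<noteq> k' \<longrightarrow> B k \<inter> B k' = {}"
    and B_cover: "(\<Union>k\<in>{1..K}. B k) = {1..N}"
    and med: "\<forall>v. is_median K v (med v)"
  shows "\<exists>E\<in>prob_space.events M.
           prob_space.prob M E \<ge> 1 - exp (- real K / 2016) \<and>
           (\<forall>\<omega>\<in>E. \<forall>fh. is_minmax_MOM med N K B lbar F (\<lambda>i. Z i \<omega>) fh \<longrightarrow>
              (L2norm (distr P MX fst) (\<lambda>x. fh x - fs x))\<^sup>2
                 \<le> max (r2\<^sup>2) (864 * A\<^sup>2 * L\<^sup>2 * real K / real N) \<and>
              excess_risk P lbar fh fs
                 \<le> 2 / (3 * A) * max (r2\<^sup>2) (864 * A\<^sup>2 * L\<^sup>2 * real K / real N))"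
proof -
  interpret M: prob_space M by (rule M)
  let ?MXY = "MX \<Otimes>\<^sub>M MY"
  define \<mu> where "\<mu> = distr P MX fst"
  define C where "C = max (r2\<^sup>2) (864 * A\<^sup>2 * L\<^sup>2 * real K / real N)"
  define \<gamma> where "\<gamma> = 1 / (575 * A * L)"
  define r where "r = sqrt C"
  define s where "s = N div K"
  define I where "I = {1..N} - Out"
  define KK where "KK = {k \<in> {1..K}. B k \<inter> Out = {}}"
  define J where "J = (\<Union>k\<in>KK. B k)"
  define n where "n = real (card KK)"

  \<comment> \<open>Arithmetic of the parameters and the outlier-free blocks\<close>
  have N_eq: "N = K * s" using K_dvd by (simp add: s_def)
  have N_pos: "N > 0" using K_pos K_upper by simp
  have s_pos: "s > 0" using N_eq N_pos by (cases s) auto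
  have fin_B: "finite (B k)" if "k \<in> {1..K}" for k
    using B_sub that finite_subset[of "B k" "{1..N}"] by auto
  have C_r2: "r2\<^sup>2 \<le> C" by (simp add: C_def)
  \<comment> \<open>The second term of the maximum enters here; it will cap the normalised
    variance.\<close>
  have C_lower: "864 * A\<^sup>2 * L\<^sup>2 \<le> real s * C"
  proof -
    have "864 * A\<^sup>2 * L\<^sup>2 = real s * (864 * A\<^sup>2 * L\<^sup>2 * real K / real N)"
      using N_eq s_pos K_pos by (simp add: field_simps)
    also have "\<dots> \<le> real s * C" by (intro mult_left_mono) (auto simp: C_def)
    finally show ?thesis .
  qed
  have C_pos: "C > 0" using C_r2 r2_pos by (smt (verit) zero_less_power)
  have r_pos: "r > 0" and r_sq: "r\<^sup>2 = C" using C_pos by (simp_all add: r_def)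
  have r2_le_r: "r2 \<le> r" unfolding r_def using C_r2 r2_pos by (intro real_le_rsqrt) auto
  have \<gamma>_pos: "\<gamma> > 0" using A_pos L_pos by (simp add: \<gamma>_def)

  have fin_KK: "finite KK" and KK_sub: "KK \<subseteq> {1..K}" by (auto simp: KK_def)
  have disj: "B k \<inter> B k' = {}" if "k \<in> {1..K}" "k' \<in> {1..K}" "k \<noteq> k'" for k k'
    using B_disj that by blast
  have fin_Out: "finite Out" using O_sub finite_subset by blast
  have KK_card: "4 * K \<le> 7 * card KK"
  proof -
    have "{1..K} = KK \<union> {k \<in> {1..K}. B k \<inter> Out \<noteq> {}}" by (auto simp: KK_def)
    then have "K \<le> card KK + card {k \<in> {1..K}. B k \<inter> Out \<noteq> {}}"
      by (metis card_Un_le card_atLeastAtMost diff_Suc_1)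
    also have "card {k \<in> {1..K}. B k \<inter> Out \<noteq> {}} \<le> card Out"
      using fin_Out disj by (rule card_hit_blocks_le)
    finally show ?thesis using K_lower by linarith
  qed
  have KK_ne: "KK \<noteq> {}" using KK_card K_pos by auto
  have n_pos: "n > 0" using KK_ne fin_KK by (simp add: n_def card_gt_0_iff)
  have n_ge: "4 * real K \<le> 7 * n" using KK_card unfolding n_def by linarith
  have card_J: "card J = card KK * s"
  proof -
    have "card J = (\<Sum>k\<in>KK. card (B k))"
      unfolding J_def using fin_KK KK_sub fin_B disj by (intro card_UN_disjoint) blast+
    also have "\<dots> = (\<Sum>k\<in>KK. s)" using B_sub KK_sub by (intro sum.cong) (auto simp: s_def)
    finally show ?thesis by simp
  qed
  have J_sub: "J \<subseteq> I" using B_sub by (auto simp: J_def I_def KK_def)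
  have J_fin: "finite J" using J_sub by (auto simp: I_def intro: finite_subset)
  \<comment> \<open>The complexity condition covers only index sets with at least
    \<open>N / 2\<close> elements; a share of 4/7 clean blocks is enough.\<close>
  have J_large: "N \<le> 2 * card J"
  proof -
    have "K \<le> 2 * card KK" using KK_card by linarith
    then show ?thesis unfolding card_J N_eq by (metis mult.assoc mult_le_mono1)
  qed
  have J_ne: "J \<noteq> {}" using J_large N_pos by auto
  have BJ: "B k \<subseteq> J" if "k \<in> KK" for k using that by (auto simp: J_def)

  \<comment> \<open>Laws of the inliers and moments of the losses\<close>
  have Z_meas: "Z i \<in> M \<rightarrow>\<^sub>M ?MXY" if "i \<in> J" for i
    using Inl_indep J_sub that unfolding M.indep_vars_def I_def by blast
  \<comment> \<open>The product locale expects a probability measure at every index;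
    \<open>P\<close> fills the places outside \<open>J\<close>.\<close>
  define Pm where "Pm i = (if i \<in> J then distr M ?MXY (Z i) else P)" for i
  have sets_Pm [measurable_cong, simp]: "sets (Pm i) = sets ?MXY" for i using P(2) by (simp add: Pm_def)
  have space_Pm: "space (Pm i) = space MX \<times> space MY" for i
    using sets_eq_imp_space_eq[OF sets_Pm] by (simp add: space_pair_measure)
  have prob_Pm: "prob_space (Pm i)" for i
    using P(1) M.prob_space_distr[OF Z_meas] by (simp add: Pm_def)
  interpret Pm: product_prob_space Pm J by (intro product_prob_spaceI prob_Pm)

  have fst_P [measurable]: "fst \<in> P \<rightarrow>\<^sub>M MX"
    using measurable_cong_sets[OF P(2) refl, of MX] measurable_fst by blast
  interpret \<mu>: prob_space \<mu> unfolding \<mu>_def by (intro prob_space.prob_space_distr P(1) fst_P)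
  have sets_\<mu> [measurable_cong, simp]: "sets \<mu> = sets MX" by (simp add: \<mu>_def)
  have MX_ne: "space MX \<noteq> {}" using \<mu>.not_empty sets_eq_imp_space_eq[OF sets_\<mu>] by simp

  define nrm where "nrm f = L2norm \<mu> (\<lambda>x. f x - fs x)" for f
  define R where "R f = excess_risk P lbar f fs" for f
  have int_diff: "integrable \<mu> (\<lambda>x. (f x - fs x)\<^sup>2)" if f: "f \<in> F" for f
  proof (rule Bochner_Integration.integrable_bound)
    have [measurable]: "f \<in> borel_measurable MX" "fs \<in> borel_measurable MX" using F_meas f fs_in by auto
    show "integrable \<mu> (\<lambda>x. 2 * (f x)\<^sup>2 + 2 * (fs x)\<^sup>2)" using F_L2 f fs_in by (auto simp: \<mu>_def)
    show "(\<lambda>x. (f x - fs x)\<^sup>2) \<in> borel_measurable \<mu>" by measurable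
    have "(f x - fs x)\<^sup>2 \<le> 2 * (f x)\<^sup>2 + 2 * (fs x)\<^sup>2" for x
      using zero_le_power2[of "f x + fs x"] by (simp add: power2_eq_square algebra_simps)
    then show "AE x in \<mu>. norm ((f x - fs x)\<^sup>2) \<le> norm (2 * (f x)\<^sup>2 + 2 * (fs x)\<^sup>2)" by simp
  qed
  have nrm_sq: "(\<integral>x. (f x - fs x)\<^sup>2 \<partial>\<mu>) = (nrm f)\<^sup>2" for f
    unfolding nrm_def L2norm_def by simp
  have nrm_nonneg: "0 \<le> nrm f" for f unfolding nrm_def L2norm_def by simp

  have F_star: "(\<lambda>x. (1 - t) * fs x + t * f x) \<in> F" if "f \<in> F" "0 \<le> t" "t \<le> 1" for f t
    using Conv fs_in that by auto
  have nrm_star: "nrm (\<lambda>x. (1 - t) * fs x + t * f x) = \<bar>t\<bar> * nrm f" for f t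
  proof -
    have "(\<lambda>x. (1 - t) * fs x + t * f x - fs x) = (\<lambda>x. t * (f x - fs x))"
      by (simp add: fun_eq_iff algebra_simps)
    then show ?thesis by (simp add: nrm_def L2norm_scale)
  qed

  define q where "q f z = lbar (f (fst z)) (snd z) - lbar (fs (fst z)) (snd z)" for f z
  define d where "d f z = f (fst z) - fs (fst z)" for f :: "'x \<Rightarrow> real" and z :: "'x \<times> 'y"
  have q_meas: "q f \<in> borel_measurable (Pm i)" if "f \<in> F" for f i
  proof -
    have "(\<lambda>z. lbar (f (fst z)) (snd z)) \<in> borel_measurable ?MXY" "(\<lambda>z. lbar (fs (fst z)) (snd z)) \<in> borel_measurable ?MXY"
      using loss_meas that fs_in by auto
    then have "q f \<in> borel_measurable ?MXY" unfolding q_def[abs_def] by measurable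
    then show ?thesis using measurable_cong_sets[OF sets_Pm refl] by blast
  qed
  \<comment> \<open>\<open>Inl_L2\<close> equates nonnegative integrals, so it transfers finiteness
    together with the value.\<close>
  have d_int: "integrable (Pm i) (\<lambda>z. (d f z)\<^sup>2)" "(\<integral>z. (d f z)\<^sup>2 \<partial>Pm i) = (nrm f)\<^sup>2"
    if f: "f \<in> F" and i: "i \<in> J" for f i
  proof -
    have [measurable]: "f \<in> borel_measurable MX" "fs \<in> borel_measurable MX" using F_meas f fs_in by auto
    note [measurable] = Z_meas[OF i]
    have "(\<integral>\<^sup>+z. ennreal ((d f z)\<^sup>2) \<partial>Pm i) = (\<integral>\<^sup>+\<omega>. ennreal ((f (fst (Z i \<omega>)) - fs (fst (Z i \<omega>)))\<^sup>2) \<partial>M)"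
      using i by (simp add: Pm_def nn_integral_distr d_def)
    also have "\<dots> = (\<integral>\<^sup>+x. ennreal ((f x - fs x)\<^sup>2) \<partial>distr M MX (\<lambda>\<omega>. fst (Z i \<omega>)))"
      by (subst nn_integral_distr) auto
    also have "\<dots> = (\<integral>\<^sup>+x. ennreal ((f x - fs x)\<^sup>2) \<partial>\<mu>)"
      using Inl_L2 J_sub i f unfolding I_def \<mu>_def by blast
    also have "\<dots> = ennreal ((nrm f)\<^sup>2)"
      using nn_integral_eq_integral[OF int_diff[OF f]] by (simp add: nrm_sq)
    finally have nn: "(\<integral>\<^sup>+z. ennreal ((d f z)\<^sup>2) \<partial>Pm i) = ennreal ((nrm f)\<^sup>2)" .
    have m: "(\<lambda>z. (d f z)\<^sup>2) \<in> borel_measurable (Pm i)" unfolding d_def by measurable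
    show "integrable (Pm i) (\<lambda>z. (d f z)\<^sup>2)"
      using m nn by (intro integrableI_nonneg) auto
    show "(\<integral>z. (d f z)\<^sup>2 \<partial>Pm i) = (nrm f)\<^sup>2"
      using m nn by (subst integral_eq_nn_integral) auto
  qed
  have q_le: "(q f z)\<^sup>2 \<le> L\<^sup>2 * (d f z)\<^sup>2" if "f \<in> F" "z \<in> space (Pm i)" for f z i
  proof -
    have "f (fst z) \<in> Ybar" "fs (fst z) \<in> Ybar" "snd z \<in> space MY"
      using that F_vals fs_in by (auto simp: space_Pm)
    then have "\<bar>q f z\<bar> \<le> L * \<bar>d f z\<bar>" using Lip_Conv unfolding q_def d_def by blast
    then have "\<bar>q f z\<bar>\<^sup>2 \<le> (L * \<bar>d f z\<bar>)\<^sup>2" by (intro power_mono) auto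
    then show ?thesis by (simp add: power_mult_distrib)
  qed
  have q2: "integrable (Pm i) (\<lambda>z. (q f z)\<^sup>2)" "(\<integral>z. (q f z)\<^sup>2 \<partial>Pm i) \<le> L\<^sup>2 * (nrm f)\<^sup>2"
    if f: "f \<in> F" and i: "i \<in> J" for f i
  proof -
    have Ld: "integrable (Pm i) (\<lambda>z. L\<^sup>2 * (d f z)\<^sup>2)" using d_int[OF f i] by simp
    show int: "integrable (Pm i) (\<lambda>z. (q f z)\<^sup>2)"
    proof (rule Bochner_Integration.integrable_bound[OF Ld])
      show "(\<lambda>z. (q f z)\<^sup>2) \<in> borel_measurable (Pm i)" using q_meas[OF f] by measurable
      show "AE z in Pm i. norm ((q f z)\<^sup>2) \<le> norm (L\<^sup>2 * (d f z)\<^sup>2)"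
        using q_le[OF f] by (intro AE_I2) simp
    qed
    have "(\<integral>z. (q f z)\<^sup>2 \<partial>Pm i) \<le> (\<integral>z. L\<^sup>2 * (d f z)\<^sup>2 \<partial>Pm i)"
      using int Ld q_le[OF f] by (rule integral_mono)
    then show "(\<integral>z. (q f z)\<^sup>2 \<partial>Pm i) \<le> L\<^sup>2 * (nrm f)\<^sup>2" using d_int[OF f i] by simp
  qed
  have q_mean: "(\<integral>z. q f z \<partial>Pm i) = R f" if f: "f \<in> F" and i: "i \<in> J" for f i
    using Inl_risk J_sub i f unfolding R_def Pm_def I_def excess_risk_def q_def by auto

  \<comment> \<open>Only at attained values \<open>v = f x\<close> is \<open>lbar v\<close> known to
    be measurable: it is the slice at \<open>x\<close> of the measurable loss of
    \<open>f\<close>.\<close>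
  define V where "V = (\<Union>f\<in>F. f ` space MX)"
  have V_ne: "V \<noteq> {}" using fs_in MX_ne by (auto simp: V_def)
  have V_Ybar: "V \<subseteq> Ybar" using F_vals by (auto simp: V_def)
  have V_meas: "lbar v \<in> borel_measurable MY" if v: "v \<in> V" for v
  proof -
    obtain f x where fx: "f \<in> F" "x \<in> space MX" "v = f x" using v by (auto simp: V_def)
    have "(\<lambda>y. (x, y)) \<in> MY \<rightarrow>\<^sub>M ?MXY" using fx by simp
    from measurable_compose[OF this] loss_meas fx
    have "(\<lambda>y. lbar (f (fst (x, y))) (snd (x, y))) \<in> borel_measurable MY" by blast
    then show ?thesis using fx by simp
  qed
  obtain lb where lb_meas: "(\<lambda>p. lb (fst p) (snd p)) \<in> borel_measurable (borel \<Otimes>\<^sub>M MY)"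
    and lb_lip: "\<And>y u v. y \<in> space MY \<Longrightarrow> \<bar>lb u y - lb v y\<bar> \<le> L * \<bar>u - v\<bar>"
    and lb_eq: "\<And>y u. y \<in> space MY \<Longrightarrow> u \<in> V \<Longrightarrow> lb u y = lbar u y"
  proof (rule lipschitz_measurable_extension[of V L MY lbar])
    show "\<bar>lbar u y - lbar v y\<bar> \<le> L * \<bar>u - v\<bar>" if "y \<in> space MY" "u \<in> V" "v \<in> V" for y u v
      using Lip_Conv V_Ybar that by blast
  qed (use V_ne L_pos V_meas in auto)
  \<comment> \<open>The contraction evaluates the loss at arguments that are not values of members of \<open>F\<close>, where nothing is
    known about the measurability of \<open>lbar\<close>; hence the extension \<open>lb\<close>.\<close>
  define \<psi> where "\<psi> z t = lb (fs (fst z) + t) (snd z) - lb (fs (fst z)) (snd z)" for z :: "'x \<times> 'y" and t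
  have \<psi>_meas: "(\<lambda>p. \<psi> (fst p) (snd p)) \<in> borel_measurable (Pm i \<Otimes>\<^sub>M borel)" for i
  proof -
    have [measurable]: "fs \<in> borel_measurable MX" using F_meas fs_in by auto
    have "(\<lambda>p. (fs (fst (fst p)) + snd p, snd (fst p))) \<in> Pm i \<Otimes>\<^sub>M borel \<rightarrow>\<^sub>M borel \<Otimes>\<^sub>M MY"
      "(\<lambda>p. (fs (fst (fst p)), snd (fst p))) \<in> Pm i \<Otimes>\<^sub>M (borel :: real measure) \<rightarrow>\<^sub>M borel \<Otimes>\<^sub>M MY"
      by measurable
    from this[THEN measurable_compose[OF _ lb_meas]] show ?thesis
      unfolding \<psi>_def by (simp add: borel_measurable_diff)
  qed
  have \<psi>_q: "\<psi> z (d f z) = q f z" if "f \<in> F" "z \<in> space (Pm i)" for f z i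
  proof -
    have "f (fst z) \<in> V" "fs (fst z) \<in> V" "snd z \<in> space MY"
      using that fs_in by (auto simp: space_Pm V_def)
    then show ?thesis by (simp add: \<psi>_def d_def q_def lb_eq)
  qed

  \<comment> \<open>The localized class, its complexity and the block deviations\<close>
  define G where "G = {f \<in> F. nrm f \<le> r}"
  have nrm_fs: "nrm fs = 0" by (simp add: nrm_def L2norm_def)
  have G_ne: "G \<noteq> {}" using fs_in r_pos nrm_fs by (auto simp: G_def)
  obtain r0 where r0: "r0 > 0" "r0 < 6 / 5 * r"
    and rad: "rad_condition \<mu> (\<lambda>i. distr M MX (\<lambda>\<omega>. fst (Z i \<omega>))) F fs I N \<gamma> r0"
  proof -
    have "r2 < 6 / 5 * r" using r2_le_r r_pos by linarith
    with r2_ge have "Inf {r. r > 0 \<and> rad_condition \<mu> (\<lambda>i. distr M MX (\<lambda>\<omega>. fst (Z i \<omega>))) F fs I N \<gamma> r} < 6 / 5 * r"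
      unfolding \<mu>_def I_def \<gamma>_def by linarith
    from cInf_lessD[OF _ this] r2_nonempty show thesis
      using that unfolding \<mu>_def I_def \<gamma>_def by blast
  qed
  \<comment> \<open>The infimum defining the complexity need not be attained, so we lose the factor \<open>6 / 5\<close>; the convexity of
    \<open>F\<close> lets us rescale from \<open>r0\<close> to \<open>r\<close>.\<close>
  define \<theta> where "\<theta> = r0 / (6 / 5 * r)"
  have \<theta>: "0 < \<theta>" "\<theta> < 1" using r0 r_pos by (auto simp: \<theta>_def)
  \<comment> \<open>The 2 dominates (13/10) * (6/5)^2 = 1.872. The factor 13/10 gives the strict
    slack for the outer integral, and \<open>r0^2 / \<theta> = r0 * (6/5) * r\<close> is at most
    \<open>(6/5)^2 * C\<close>.\<close>
  define u where "u = 2 * C * real (card J) * \<gamma>"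
  obtain U where U: "\<And>S. S \<subseteq> J \<Longrightarrow> integrable (PiM J Pm) (U S)"
    and U_maj: "AE z in PiM J Pm. \<forall>f\<in>G. \<forall>S. S \<subseteq> J \<longrightarrow> (\<Sum>i\<in>J. sg S i * d f (z i)) \<le> U S z"
    and U_sum: "(\<Sum>S\<in>Pow J. \<integral>z. U S z \<partial>PiM J Pm) \<le> 2 ^ card J * u"
  proof -
    define b where "b = r0\<^sup>2 * real (card J) * \<gamma>"
    have J_pos: "real (card J) > 0" using J_ne J_fin by (simp add: card_gt_0_iff)
    have b_pos: "b > 0" using r0 J_pos \<gamma>_pos by (simp add: b_def)
    define G' where "G' = {f \<in> F. nrm f \<le> r0}"
    have fst_Pm: "fst \<in> Pm i \<rightarrow>\<^sub>M MX" for i by measurable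
    have "distr (Pm i) MX fst = distr M MX (\<lambda>\<omega>. fst (Z i \<omega>))" if "i \<in> J" for i
      using that Z_meas[OF that] by (simp add: Pm_def distr_distr comp_def)
    then have PiM_eq: "PiM J (\<lambda>i. distr (Pm i) MX fst \<Otimes>\<^sub>M rademacher) = PiM J (\<lambda>i. distr M MX (\<lambda>\<omega>. fst (Z i \<omega>)) \<Otimes>\<^sub>M rademacher)"
      by (intro PiM_cong) auto
    have outer: "outer_nn_integral (PiM J (\<lambda>i. distr (Pm i) MX fst \<Otimes>\<^sub>M rademacher))
        (\<lambda>w. SUP f\<in>G'. ennreal \<bar>\<Sum>i\<in>J. snd (w i) * (f (fst (w i)) - fs (fst (w i)))\<bar>) \<le> ennreal b"
      using rad J_sub J_large unfolding rad_condition_def PiM_eq G'_def b_def nrm_def by simp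
    obtain U' where U': "\<And>S. S \<subseteq> J \<Longrightarrow> integrable (PiM J Pm) (U' S)"
      and U'_maj: "AE z in PiM J Pm. \<forall>f\<in>G'. \<forall>S. S \<subseteq> J \<longrightarrow> \<bar>\<Sum>i\<in>J. sg S i * (f (fst (z i)) - fs (fst (z i)))\<bar> \<le> U' S z"
      and U'_sum: "(\<Sum>S\<in>Pow J. \<integral>z. U' S z \<partial>PiM J Pm) \<le> 2 ^ card J * (13 / 10 * b)"
      by (rule Pm.outer_rademacher_majorants[OF J_fin fst_Pm, where d="\<lambda>f x. f x - fs x" and G=G' and b=b and b'="13 / 10 * b"])
        (assumption | rule that outer | use b_pos in simp)+
    show thesis
    proof (rule that[of "\<lambda>S z. U' S z / \<theta>"])
      show "integrable (PiM J Pm) (\<lambda>z. U' S z / \<theta>)" if "S \<subseteq> J" for S using U'[OF that] by simp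
      show "AE z in PiM J Pm. \<forall>f\<in>G. \<forall>S. S \<subseteq> J \<longrightarrow> (\<Sum>i\<in>J. sg S i * d f (z i)) \<le> U' S z / \<theta>"
        using U'_maj
      proof (rule AE_mp_space, intro ballI allI impI)
        fix z f S assume *: "\<forall>f\<in>G'. \<forall>S. S \<subseteq> J \<longrightarrow> \<bar>\<Sum>i\<in>J. sg S i * (f (fst (z i)) - fs (fst (z i)))\<bar> \<le> U' S z"
          and f: "f \<in> G" and S: "S \<subseteq> J"
        \<comment> \<open>Shrinking towards \<open>fs\<close> by \<open>\<theta>\<close> reaches the
          ball of radius \<open>r0\<close>; the signed sum is linear in \<open>f - fs\<close> and
          shrinks by the same factor.\<close>
        define f' where "f' = (\<lambda>x. (1 - \<theta>) * fs x + \<theta> * f x)"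
        have "\<theta> * nrm f \<le> \<theta> * r" using f \<theta> by (intro mult_left_mono) (auto simp: G_def)
        also have "\<dots> \<le> r0" using r0 r_pos by (simp add: \<theta>_def)
        finally have "f' \<in> G'" unfolding G'_def f'_def using f \<theta> F_star by (simp add: nrm_star G_def)
        with * S have "(\<Sum>i\<in>J. sg S i * (f' (fst (z i)) - fs (fst (z i)))) \<le> U' S z" by (auto simp: abs_le_iff)
        also have "(\<Sum>i\<in>J. sg S i * (f' (fst (z i)) - fs (fst (z i)))) = \<theta> * (\<Sum>i\<in>J. sg S i * d f (z i))"
          unfolding sum_distrib_left by (intro sum.cong) (auto simp: f'_def d_def algebra_simps)
        finally show "(\<Sum>i\<in>J. sg S i * d f (z i)) \<le> U' S z / \<theta>"
          using \<theta> by (simp add: pos_le_divide_eq mult.commute)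
      qed
      have "(\<Sum>S\<in>Pow J. \<integral>z. U' S z / \<theta> \<partial>PiM J Pm) = (\<Sum>S\<in>Pow J. \<integral>z. U' S z \<partial>PiM J Pm) / \<theta>"
        by (simp add: sum_divide_distrib)
      also have "\<dots> \<le> 2 ^ card J * (13 / 10 * b) / \<theta>"
        using U'_sum \<theta> by (intro divide_right_mono) auto
      also have "\<dots> = 2 ^ card J * (39 / 25 * (r0 * r) * (real (card J) * \<gamma>))"
        using r0 r_pos by (simp add: b_def \<theta>_def field_simps power2_eq_square)
      also have "\<dots> \<le> 2 ^ card J * (39 / 25 * (6 / 5 * r * r) * (real (card J) * \<gamma>))"
        using r0 r_pos J_pos \<gamma>_pos by (intro mult_left_mono mult_right_mono) auto
      also have "\<dots> \<le> 2 ^ card J * u"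
        using J_pos \<gamma>_pos C_pos r_sq by (auto simp: u_def power2_eq_square mult.assoc intro!: mult_right_mono)
      finally show "(\<Sum>S\<in>Pow J. \<integral>z. U' S z / \<theta> \<partial>PiM J Pm) \<le> 2 ^ card J * u" .
    qed
  qed

  \<comment> \<open>A block sum has \<open>s\<close> terms, so a deviation of
    \<open>C / (3 * A)\<close> in the block mean is scaled to exactly 1.\<close>
  define c where "c = 3 * A / (real s * C)"
  have c_pos: "c > 0" using A_pos s_pos C_pos by (simp add: c_def)
  let ?D = "\<lambda>k. PiM (B k) Pm"
  obtain E where E: "E \<in> sets (PiM KK ?D)"
    and E_prob: "measure (PiM KK ?D) E \<ge> 1 - exp (- 2 * (n / 48)\<^sup>2 / real (card KK))"
    and E_dev: "\<And>w f. w \<in> E \<Longrightarrow> f \<in> G \<Longrightarrow>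
      (\<Sum>k\<in>KK. min 1 ((c * (\<Sum>i\<in>B k. q f (w k i) - (\<integral>y. q f y \<partial>Pm i)))\<^sup>2))
        \<le> c\<^sup>2 * (real (card J) * (L\<^sup>2 * C)) + 8 * c * L * u + n / 48"
  proof (rule Pm.blocks_deviation[of KK B J G U d u L c "n / 48" \<psi> q "L\<^sup>2 * C"])
    show "finite (B k)" if "k \<in> KK" for k using that fin_B KK_sub by blast
    show "B k \<inter> B k' = {}" if "k \<in> KK" "k' \<in> KK" "k \<noteq> k'" for k k' using that disj KK_sub by blast
    show "\<bar>\<psi> y s - \<psi> y t\<bar> \<le> L * \<bar>s - t\<bar>" if "y \<in> space (Pm i)" for i y s t
      using lb_lip[of "snd y" "fs (fst y) + s" "fs (fst y) + t"] that by (auto simp: \<psi>_def space_Pm)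
    show "\<psi> y (d f y) = q f y" if "f \<in> G" "y \<in> space (Pm i)" for f i y
      using \<psi>_q that by (auto simp: G_def)
    show "q f \<in> borel_measurable (Pm i)" if "f \<in> G" for f i using q_meas that by (auto simp: G_def)
    show "integrable (Pm i) (\<lambda>y. (q f y)\<^sup>2)" if "f \<in> G" "i \<in> J" for f i
      using q2 that by (auto simp: G_def)
    show "(\<integral>y. (q f y)\<^sup>2 \<partial>Pm i) \<le> L\<^sup>2 * C" if f: "f \<in> G" and i: "i \<in> J" for f i
    proof -
      have "(nrm f)\<^sup>2 \<le> r\<^sup>2" using f nrm_nonneg by (intro power_mono) (auto simp: G_def)
      then have "L\<^sup>2 * (nrm f)\<^sup>2 \<le> L\<^sup>2 * C" unfolding r_sq by (intro mult_left_mono) auto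
      then show ?thesis using q2(2)[of f i] f i by (auto simp: G_def)
    qed
    show "AE z in PiM J Pm. \<forall>f\<in>G. \<forall>S. S \<subseteq> J \<longrightarrow> (\<Sum>i\<in>J. sg S i * d f (z i)) \<le> U S z" by (rule U_maj)
    show "(\<lambda>p. \<psi> (fst p) (snd p)) \<in> borel_measurable (Pm i \<Otimes>\<^sub>M borel)" for i by (rule \<psi>_meas)
    show "integrable (PiM J Pm) (U S)" if "S \<subseteq> J" for S using that by (rule U)
    show "\<psi> y 0 = 0" for y by (simp add: \<psi>_def)
    show "n / 48 > 0" using n_pos by simp
    show "J = \<Union> (B ` KK)" by (simp add: J_def)
  qed (assumption | rule that fin_KK KK_ne G_ne U_sum L_pos c_pos)+

  have dev_small: "c\<^sup>2 * (real (card J) * (L\<^sup>2 * C)) + 8 * c * L * u + n / 48 < n / 8"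
  proof -
    have cJ: "real (card J) = n * real s" by (simp add: card_J n_def)
    have sC: "real s * C > 0" using s_pos C_pos by simp
    have "c\<^sup>2 * (real (card J) * (L\<^sup>2 * C)) = n * (9 * A\<^sup>2 * L\<^sup>2 / (real s * C))"
      using s_pos C_pos by (simp add: c_def cJ field_simps power2_eq_square)
    also have "\<dots> \<le> n * (1 / 96)"
      using C_lower sC n_pos by (intro mult_left_mono) (auto simp: field_simps)
    finally have 1: "c\<^sup>2 * (real (card J) * (L\<^sup>2 * C)) \<le> n / 96" by simp
    have 2: "8 * c * L * u = n * (48 / 575)"
      using s_pos C_pos A_pos L_pos by (simp add: c_def u_def \<gamma>_def cJ field_simps)
    show ?thesis unfolding 2 using 1 n_pos by linarith
  qed

  \<comment> \<open>Transfer from the product space of blocks to the sample\<close>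
  have B_Pm: "PiM (B k) Pm = PiM (B k) (\<lambda>i. distr M ?MXY (Z i))" if "k \<in> KK" for k
    using BJ[OF that] by (intro PiM_cong) (auto simp: Pm_def)
  define W where "W \<omega> = (\<lambda>k\<in>KK. \<lambda>i\<in>B k. Z i \<omega>)" for \<omega>
  have W_distr: "distr M (PiM KK (\<lambda>k. PiM (B k) (\<lambda>_. ?MXY))) W = PiM KK ?D"
    and W_meas: "W \<in> M \<rightarrow>\<^sub>M PiM KK (\<lambda>k. PiM (B k) (\<lambda>_. ?MXY))"
  proof -
    have blk: "(\<lambda>\<omega>. \<lambda>i\<in>B k. Z i \<omega>) \<in> M \<rightarrow>\<^sub>M PiM (B k) (\<lambda>_. ?MXY)" if "k \<in> KK" for k
      using Z_meas BJ[OF that] by (intro measurable_restrict) auto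
    show "W \<in> M \<rightarrow>\<^sub>M PiM KK (\<lambda>k. PiM (B k) (\<lambda>_. ?MXY))"
      unfolding W_def using blk by (rule measurable_restrict)
    \<comment> \<open>Independence is used twice: between blocks, as disjoint groups of independent
      variables, and inside each block, where it gives the product law.\<close>
    have indep: "M.indep_vars (\<lambda>k. PiM (B k) (\<lambda>_. ?MXY)) (\<lambda>k \<omega>. \<lambda>i\<in>B k. Z i \<omega>) KK"
    proof (rule M.indep_vars_restrict[OF Inl_indep])
      show "B k \<subseteq> {1..N} - Out" if "k \<in> KK" for k using BJ[OF that] J_sub by (simp add: I_def)
      show "disjoint_family_on B KK" using disj KK_sub unfolding disjoint_family_on_def by blast
    qed
    have law: "distr M (PiM (B k) (\<lambda>_. ?MXY)) (\<lambda>\<omega>. \<lambda>i\<in>B k. Z i \<omega>) = ?D k" if k: "k \<in> KK" for k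
    proof -
      have "card (B k) = s" using B_sub KK_sub k by (auto simp: s_def)
      then have ne: "B k \<noteq> {}" using s_pos by auto
      have "M.indep_vars (\<lambda>_. ?MXY) Z (B k)"
        using Inl_indep BJ[OF k] J_sub unfolding I_def by (meson M.indep_vars_subset order_trans)
      then show ?thesis
        using M.indep_vars_iff_distr_eq_PiM'[OF ne, of Z "\<lambda>_. ?MXY"] Z_meas BJ[OF k] B_Pm[OF k] by auto
    qed
    have "distr M (PiM KK (\<lambda>k. PiM (B k) (\<lambda>_. ?MXY))) W = PiM KK (\<lambda>k. distr M (PiM (B k) (\<lambda>_. ?MXY)) (\<lambda>\<omega>. \<lambda>i\<in>B k. Z i \<omega>))"
      unfolding W_def by (rule M.indep_vars_iff_distr_eq_PiM'[THEN iffD1, OF KK_ne _ indep]) (rule blk)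
    also have "\<dots> = PiM KK ?D" using law by (intro PiM_cong) auto
    finally show "distr M (PiM KK (\<lambda>k. PiM (B k) (\<lambda>_. ?MXY))) W = PiM KK ?D" .
  qed
  have E_sets: "E \<in> sets (PiM KK (\<lambda>k. PiM (B k) (\<lambda>_. ?MXY)))"
    using E unfolding W_distr[symmetric] by simp
  define \<Omega> where "\<Omega> = W -` E \<inter> space M"
  show ?thesis
  proof (intro bexI[of _ \<Omega>] conjI)
    show "\<Omega> \<in> M.events" unfolding \<Omega>_def using W_meas E_sets by (rule measurable_sets)
    have "2 * (n / 48)\<^sup>2 / real (card KK) \<ge> real K / 2016"
      using n_ge n_pos by (simp add: n_def[symmetric] power2_eq_square)
    then have "1 - exp (- real K / 2016) \<le> 1 - exp (- 2 * (n / 48)\<^sup>2 / real (card KK))" by simp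
    also have "\<dots> \<le> measure (PiM KK ?D) E" by (rule E_prob)
    also have "\<dots> = M.prob \<Omega>"
      unfolding W_distr[symmetric] \<Omega>_def using W_meas E_sets by (rule measure_distr)
    finally show "1 - exp (- real K / 2016) \<le> M.prob \<Omega>" .
    show "\<forall>\<omega>\<in>\<Omega>. \<forall>fh. is_minmax_MOM med N K B lbar F (\<lambda>i. Z i \<omega>) fh \<longrightarrow>
        (L2norm (distr P MX fst) (\<lambda>x. fh x - fs x))\<^sup>2 \<le> max (r2\<^sup>2) (864 * A\<^sup>2 * L\<^sup>2 * real K / real N) \<and>
        excess_risk P lbar fh fs \<le> 2 / (3 * A) * max (r2\<^sup>2) (864 * A\<^sup>2 * L\<^sup>2 * real K / real N)"
    proof (intro ballI allI impI)

      \<comment> \<open>Counting bad blocks on the event, and the deterministic conclusion\<close>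
      fix \<omega> fh assume \<omega>: "\<omega> \<in> \<Omega>" and fh: "is_minmax_MOM med N K B lbar F (\<lambda>i. Z i \<omega>) fh"
      have \<omega>M: "\<omega> \<in> space M" and WE: "W \<omega> \<in> E" using \<omega> by (auto simp: \<Omega>_def)
      have Z_space: "Z i \<omega> \<in> space MX \<times> space MY" if "i \<in> J" for i
        using measurable_space[OF Z_meas[OF that] \<omega>M] by (simp add: space_pair_measure)
      have good: "K < 2 * card {k \<in> KK. \<bar>block_mean N K (B k) (\<lambda>i. q f (Z i \<omega>)) - R f\<bar> \<le> r\<^sup>2 / (3 * A)}"
        if f: "f \<in> F" "nrm f \<le> r" for f
      proof -
        define bad where "bad = {k \<in> KK. \<not> \<bar>block_mean N K (B k) (\<lambda>i. q f (Z i \<omega>)) - R f\<bar> \<le> r\<^sup>2 / (3 * A)}"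
        define Gd where "Gd = {k \<in> KK. \<bar>block_mean N K (B k) (\<lambda>i. q f (Z i \<omega>)) - R f\<bar> \<le> r\<^sup>2 / (3 * A)}"
        define e where "e k = min 1 ((c * (\<Sum>i\<in>B k. q f (W \<omega> k i) - (\<integral>y. q f y \<partial>Pm i)))\<^sup>2)" for k
        \<comment> \<open>On a bad block the normalised deviation is at least 1 and the truncation
          is saturated, so the sum of \<open>e\<close> is at least the number of bad blocks.\<close>
        have "e k = 1" if k: "k \<in> bad" for k
        proof -
          have kK: "k \<in> KK" using k by (simp add: bad_def)
          have cB: "card (B k) = s" using B_sub KK_sub kK by (auto simp: s_def)
          have "(\<Sum>i\<in>B k. q f (W \<omega> k i) - (\<integral>y. q f y \<partial>Pm i)) = (\<Sum>i\<in>B k. q f (Z i \<omega>) - R f)"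
            using kK q_mean[OF f(1)] BJ[OF kK] by (intro sum.cong) (auto simp: W_def)
          also have "\<dots> = (\<Sum>i\<in>B k. q f (Z i \<omega>)) - real s * R f" by (simp add: sum_subtractf cB)
          also have "\<dots> = real s * (block_mean N K (B k) (\<lambda>i. q f (Z i \<omega>)) - R f)"
            using N_eq s_pos K_pos by (simp add: block_mean_def algebra_simps)
          finally have "\<bar>c * (\<Sum>i\<in>B k. q f (W \<omega> k i) - (\<integral>y. q f y \<partial>Pm i))\<bar>
              = 3 * A / C * \<bar>block_mean N K (B k) (\<lambda>i. q f (Z i \<omega>)) - R f\<bar>"
            using s_pos A_pos C_pos by (simp add: c_def abs_mult)
          also have "\<dots> \<ge> 3 * A / C * (C / (3 * A))"
            using k A_pos C_pos unfolding bad_def r_sq by (intro mult_left_mono) auto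
          also have "3 * A / C * (C / (3 * A)) = 1" using A_pos C_pos by simp
          finally have "1 \<le> \<bar>c * (\<Sum>i\<in>B k. q f (W \<omega> k i) - (\<integral>y. q f y \<partial>Pm i))\<bar>" .
          from power_mono[OF this, of 2]
          have "1 \<le> (c * (\<Sum>i\<in>B k. q f (W \<omega> k i) - (\<integral>y. q f y \<partial>Pm i)))\<^sup>2"
            unfolding power2_abs by (simp only: one_power2)
          then show ?thesis by (simp add: e_def)
        qed
        then have "real (card bad) = (\<Sum>k\<in>bad. e k)" by simp
        also have "\<dots> \<le> (\<Sum>k\<in>KK. e k)"
          using fin_KK by (intro sum_mono2) (auto simp: bad_def e_def)
        also have "\<dots> < n / 8"
          unfolding e_def using E_dev[OF WE, of f] f dev_small by (auto simp: G_def)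
        finally have "real (card bad) < n / 8" .
        moreover have "card KK = card Gd + card bad"
          using fin_KK unfolding Gd_def bad_def
          by (subst card_Un_disjoint[symmetric]) (auto intro!: arg_cong[where f=card])
        ultimately have "real K < 2 * real (card Gd)" using n_ge by (simp add: n_def)
        then show ?thesis by (simp add: Gd_def)
      qed
      have "L2norm \<mu> (\<lambda>x. fh x - fs x) \<le> r \<and> R fh \<le> 2 / (3 * A) * r\<^sup>2"
      proof (rule minmax_MOM_error_bound[OF _ KK_sub _ _ _ F_star fs_in A_pos r_pos _ _ _ fh, where S="space MX" and Y="space MY"])
        show "is_median K v (med v)" for v using med by blast
        show "fst (Z i \<omega>) \<in> space MX \<and> snd (Z i \<omega>) \<in> space MY" if "k \<in> KK" "i \<in> B k" for k i
          using Z_space[of i] BJ[OF that(1)] that(2) by (auto simp: mem_Times_iff)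
        show "f x \<in> Ybar" if "f \<in> F" "x \<in> space MX" for f x using F_vals that by blast
        show "convex_on Ybar (\<lambda>u. lbar u y)" if "y \<in> space MY" for y using Lip_Conv that by blast
        show "0 \<le> R f" if "f \<in> F" for f using fs_min that by (simp add: R_def)
        show "r\<^sup>2 \<le> A * R f" if "f \<in> F" "L2norm \<mu> (\<lambda>x. f x - fs x) = r" for f
          using Bern_MOM that r_sq unfolding R_def \<mu>_def C_def by metis
        show "K < 2 * card {k \<in> KK. \<bar>block_mean N K (B k) (\<lambda>i. lbar (f (fst (Z i \<omega>))) (snd (Z i \<omega>)) - lbar (fs (fst (Z i \<omega>))) (snd (Z i \<omega>))) - R f\<bar> \<le> r\<^sup>2 / (3 * A)}"
          if "f \<in> F" "L2norm \<mu> (\<lambda>x. f x - fs x) \<le> r" for f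
          using good[of f] that by (simp add: nrm_def q_def)
      qed
      then have "nrm fh \<le> r" "R fh \<le> 2 / (3 * A) * C" by (simp_all add: nrm_def r_sq)
      moreover have "(nrm fh)\<^sup>2 \<le> C"
        using power_mono[OF \<open>nrm fh \<le> r\<close> nrm_nonneg, of 2] by (simp add: r_sq)
      ultimately show "(L2norm (distr P MX fst) (\<lambda>x. fh x - fs x))\<^sup>2 \<le> max (r2\<^sup>2) (864 * A\<^sup>2 * L\<^sup>2 * real K / real N) \<and>
        excess_risk P lbar fh fs \<le> 2 / (3 * A) * max (r2\<^sup>2) (864 * A\<^sup>2 * L\<^sup>2 * real K / real N)"
        by (simp add: nrm_def R_def \<mu>_def C_def)
    qed
  qed
qed

end
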